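(* Let $H$ be a separable complex Hilbert space, $A$ a strictly positive selfadjoint operator on $H$, and $f:\sigma(A)\to[0,\infty)$ a continuous function. Let $\mathbb{A}$ be the operator $\mathbb{A}(u,v)=(v,-Au-f(A)v)$ on $\mathcal{H}=H^1\times H$ defined in the context. For $s\in\sigma(A)$ set $$\xi_s^{\pm}=\begin{cases}-\dfrac{f(s)}{2}\pm\dfrac{\sqrt{f(s)^2-4s}}{2}&\text{if } f(s)\ge 2\sqrt{s},\\[2mm]-\dfrac{f(s)}{2}\pm i\,\dfrac{\sqrt{4s-f(s)^2}}{2}&\text{if } f(s)<2\sqrt{s},\end{cases}$$ and let $$\Lambda=\Big\{\ell>0:\ \exists\, s_n\in\sigma(A)\ \text{such that}\ s_n\to\infty\ \text{and}\ \lim_{n\to\infty}\frac{f(s_n)}{s_n}=\ell\Big\}$$ (possibly empty). Then $$\sigma(\mathbb{A})\setminus\{0\}=\bigcup_{s\in\sigma(A)}\{\xi_s^{+},\xi_s^{-}\}\ \cup\ \bigcup_{\ell\in\Lambda}\Big\{-\frac1\ell\Big\}.$$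
   Context: $(H,\langle\cdot,\cdot\rangle,\|\cdot\|)$ is a separable complex Hilbert space and $A:\mathrm{dom}(A)\subset H\to H$ is a strictly positive selfadjoint linear operator (so $\sigma(A)$ is a nonempty closed subset of $(0,\infty)$; $A$ may be bounded or unbounded and $A^{-1}$ is not necessarily compact). $f:\sigma(A)\to[0,\infty)$ is continuous, and $f(A)=\int_{\sigma(A)}f(s)\,dE_A(s)$ is the selfadjoint operator given by the functional calculus, $E_A$ being the spectral measure of $A$. For $r>0$, $H^r=\mathrm{dom}(A^{r/2})$ with norm $\|u\|_r=\|A^{r/2}u\|$. The phase space is $\mathcal{H}=H^1\times H$ with norm $\|(u,v)\|_{\mathcal{H}}^2=\|u\|_1^2+\|v\|^2$. The operator $\mathbb{A}$ is $\mathbb{A}(u,v)=(v,\,-(Au+f(A)v))$ with domain $\mathrm{dom}(\mathbb{A})=\{(u,v)\in\mathcal{H}: v\in H^1,\ Au+f(A)v\in H\}$. Here, when $u\notin\mathrm{dom}(A)$ or $v\notin\mathrm{dom}(f(A))$, $Au$ and $f(A)v$ are understood by duality, as the functionals $w\mapsto\langle Aw,u\rangle$ on $\mathrm{dom}(A)$ and $w\mapsto\langle f(A)w,v\rangle$ on $\mathrm{dom}(f(A))$; thus $Au+f(A)v\in H$ means that there is $h\in H$ (then denoted $Au+f(A)v$) with $\langle Aw,u\rangle+\langle f(A)w,v\rangle=\langle w,h\rangle$ for all $w\in\mathrm{dom}(A)\cap\mathrm{dom}(f(A))$. The operator $\mathbb{A}$ is closed and densely defined. *)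

theory Defs
  imports "HOL-Analysis.Analysis"
begin

section \<open>Complex Hilbert spaces\<close>

class complex_vector = real_vector +
  fixes scaleC :: "complex \<Rightarrow> 'a \<Rightarrow> 'a"  (infixr "*\<^sub>C" 75)
  assumes scaleC_add_right: "a *\<^sub>C (x + y) = a *\<^sub>C x + a *\<^sub>C y"
    and scaleC_add_left: "(a + b) *\<^sub>C x = a *\<^sub>C x + b *\<^sub>C x"
    and scaleC_scaleC: "a *\<^sub>C (b *\<^sub>C x) = (a * b) *\<^sub>C x"
    and scaleC_complex_of_real: "complex_of_real r *\<^sub>C x = r *\<^sub>R x"

instantiation prod :: (complex_vector, complex_vector) complex_vector
begin

definition scaleC_prod_def: "a *\<^sub>C p = (a *\<^sub>C fst p, a *\<^sub>C snd p)"

instance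
  by standard
    (simp_all add: scaleC_prod_def scaleC_add_right scaleC_add_left scaleC_scaleC
      scaleC_complex_of_real scaleR_prod_def)

end

text \<open>The inner product is linear in its first argument. Completeness comes from \<^class>\<open>banach\<close>.\<close>

class complex_hilbert_space = complex_vector + banach +
  fixes cinner :: "'a \<Rightarrow> 'a \<Rightarrow> complex"
  assumes cinner_commute: "cinner x y = cnj (cinner y x)"
    and cinner_add_left: "cinner (x + y) z = cinner x z + cinner y z"
    and cinner_scaleC_left: "cinner (a *\<^sub>C x) y = a * cinner x y"
    and cinner_self: "cinner x x = complex_of_real ((norm x)\<^sup>2)"


section \<open>Unbounded operators\<close>

text \<open>
  An operator is a pair of its domain and a function; the values of the function off the
  domain are irrelevant.
\<close>

type_synonym 'a opr = "'a set \<times> ('a \<Rightarrow> 'a)"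

definition op_dom :: "'a opr \<Rightarrow> 'a set" where
  "op_dom T = fst T"

definition op_app :: "'a opr \<Rightarrow> 'a \<Rightarrow> 'a" where
  "op_app T = snd T"

definition op_eq :: "'a opr \<Rightarrow> 'a opr \<Rightarrow> bool" where
  "op_eq S T \<longleftrightarrow> op_dom S = op_dom T \<and> (\<forall>x\<in>op_dom S. op_app S x = op_app T x)"

definition linear_opr :: "'a::complex_vector opr \<Rightarrow> bool" where
  "linear_opr T \<longleftrightarrow>
     0 \<in> op_dom T \<and>
     (\<forall>x\<in>op_dom T. \<forall>y\<in>op_dom T.
        x + y \<in> op_dom T \<and> op_app T (x + y) = op_app T x + op_app T y) \<and>
     (\<forall>a. \<forall>x\<in>op_dom T. a *\<^sub>C x \<in> op_dom T \<and> op_app T (a *\<^sub>C x) = a *\<^sub>C op_app T x)"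

definition densely_defined :: "'a::topological_space opr \<Rightarrow> bool" where
  "densely_defined T \<longleftrightarrow> closure (op_dom T) = UNIV"

definition adjoint_opr :: "'a::complex_hilbert_space opr \<Rightarrow> 'a opr" where
  "adjoint_opr T =
     ({y. \<exists>z. \<forall>x\<in>op_dom T. cinner (op_app T x) y = cinner x z},
      \<lambda>y. THE z. \<forall>x\<in>op_dom T. cinner (op_app T x) y = cinner x z)"

definition selfadjoint :: "'a::complex_hilbert_space opr \<Rightarrow> bool" where
  "selfadjoint T \<longleftrightarrow> linear_opr T \<and> densely_defined T \<and> op_eq (adjoint_opr T) T"

definition strictly_positive :: "'a::complex_hilbert_space opr \<Rightarrow> bool" where
  "strictly_positive T \<longleftrightarrow>
     (\<exists>c>0. \<forall>x\<in>op_dom T. c * (norm x)\<^sup>2 \<le> Re (cinner (op_app T x) x))"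

text \<open>
  The ambient space is given by a carrier \<open>X\<close> with a norm \<open>N\<close>, because the phase space
  below is a subspace of \<open>'a \<times> 'a\<close> with a norm of its own. The resolvent set consists of the
  \<open>z\<close> for which \<open>z - T\<close> is a bijection from the domain onto \<open>X\<close> with \<open>N\<close>-bounded inverse.
\<close>

definition resolvent_set ::
  "'a::complex_vector set \<Rightarrow> ('a \<Rightarrow> real) \<Rightarrow> 'a opr \<Rightarrow> complex set" where
  "resolvent_set X N T =
     {z. bij_betw (\<lambda>x. z *\<^sub>C x - op_app T x) (op_dom T) X \<and>
         (\<exists>C. \<forall>x\<in>op_dom T. N x \<le> C * N (z *\<^sub>C x - op_app T x))}"

definition spectrum :: "'a::complex_vector set \<Rightarrow> ('a \<Rightarrow> real) \<Rightarrow> 'a opr \<Rightarrow> complex set" where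
  "spectrum X N T = UNIV - resolvent_set X N T"

text \<open>The spectrum of a selfadjoint operator is real; this is that spectrum as a set of reals.\<close>

definition real_spectrum :: "'a::complex_hilbert_space opr \<Rightarrow> real set" where
  "real_spectrum T = {s. complex_of_real s \<in> spectrum UNIV norm T}"


section \<open>Spectral measures and functional calculus\<close>

definition orthogonal_projection :: "('a::complex_hilbert_space \<Rightarrow> 'a) \<Rightarrow> bool" where
  "orthogonal_projection P \<longleftrightarrow>
     linear_opr (UNIV, P) \<and> (\<forall>x. P (P x) = P x) \<and> (\<forall>x y. cinner (P x) y = cinner x (P y))"

definition projection_valued_measure ::
  "(real set \<Rightarrow> 'a::complex_hilbert_space \<Rightarrow> 'a) \<Rightarrow> bool" where
  "projection_valued_measure E \<longleftrightarrow>
     (\<forall>B\<in>sets borel. orthogonal_projection (E B)) \<and>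
     (\<forall>x. E UNIV x = x) \<and>
     (\<forall>B\<in>sets borel. \<forall>C\<in>sets borel. \<forall>x. E (B \<inter> C) x = E B (E C x)) \<and>
     (\<forall>B :: nat \<Rightarrow> real set. range B \<subseteq> sets borel \<longrightarrow> disjoint_family B \<longrightarrow>
        (\<forall>x. (\<lambda>n. E (B n) x) sums E (\<Union>n. B n) x))"

definition scalar_measure ::
  "(real set \<Rightarrow> 'a::complex_hilbert_space \<Rightarrow> 'a) \<Rightarrow> 'a \<Rightarrow> real measure" where
  "scalar_measure E x = measure_of UNIV (sets borel) (\<lambda>B. ennreal (Re (cinner (E B x) x)))"

text \<open>
  The operator \<open>\<integral>\<^sub>S g dE\<close>. Its domain consists of the \<open>x\<close> with \<open>\<integral>\<^sub>S g\<^sup>2 d\<langle>E x, x\<rangle> < \<infinity>\<close>, and its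
  value \<open>h\<close> at \<open>x\<close> is given by \<open>\<langle>h, y\<rangle> = \<integral>\<^sub>S g d\<langle>E x, y\<rangle>\<close>. The complex measure \<open>\<langle>E x, y\<rangle>\<close> is
  expressed by polarization through finite positive ones; for \<open>x\<close> and \<open>y\<close> in the domain all four
  integrals converge, and such \<open>y\<close> determine \<open>h\<close> since the domain is dense.
\<close>

definition spectral_integral ::
  "(real set \<Rightarrow> 'a::complex_hilbert_space \<Rightarrow> 'a) \<Rightarrow> real set \<Rightarrow> (real \<Rightarrow> real) \<Rightarrow> 'a opr" where
  "spectral_integral E S g =
     (let D = {x. set_integrable (scalar_measure E x) S (\<lambda>s. (g s)\<^sup>2)}
      in (D, \<lambda>x. THE h. \<forall>y\<in>D.
            cinner h y =
              (\<Sum>k<4. \<i> ^ k * complex_of_real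
                 (set_lebesgue_integral (scalar_measure E (x + \<i> ^ k *\<^sub>C y)) S g)) / 4))"

definition spectral_measure_of ::
  "(real set \<Rightarrow> 'a::complex_hilbert_space \<Rightarrow> 'a) \<Rightarrow> 'a opr \<Rightarrow> bool" where
  "spectral_measure_of E T \<longleftrightarrow>
     projection_valued_measure E \<and> op_eq T (spectral_integral E UNIV (\<lambda>s. s))"

text \<open>In the following, \<open>E\<close> is the spectral measure of \<open>A\<close>.\<close>

definition func_calc ::
  "'a::complex_hilbert_space opr \<Rightarrow> (real set \<Rightarrow> 'a \<Rightarrow> 'a) \<Rightarrow> (real \<Rightarrow> real) \<Rightarrow> 'a opr" where
  "func_calc A E g = spectral_integral E (real_spectrum A) g"


section \<open>The damped operator on the phase space\<close>

definition opr_powr ::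
  "'a::complex_hilbert_space opr \<Rightarrow> (real set \<Rightarrow> 'a \<Rightarrow> 'a) \<Rightarrow> real \<Rightarrow> 'a opr" where
  "opr_powr A E r = func_calc A E (\<lambda>s. s powr r)"

definition scale_space ::
  "'a::complex_hilbert_space opr \<Rightarrow> (real set \<Rightarrow> 'a \<Rightarrow> 'a) \<Rightarrow> real \<Rightarrow> 'a set" where
  "scale_space A E r = op_dom (opr_powr A E (r / 2))"

definition scale_norm ::
  "'a::complex_hilbert_space opr \<Rightarrow> (real set \<Rightarrow> 'a \<Rightarrow> 'a) \<Rightarrow> real \<Rightarrow> 'a \<Rightarrow> real" where
  "scale_norm A E r u = norm (op_app (opr_powr A E (r / 2)) u)"

definition phase_space ::
  "'a::complex_hilbert_space opr \<Rightarrow> (real set \<Rightarrow> 'a \<Rightarrow> 'a) \<Rightarrow> ('a \<times> 'a) set" where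
  "phase_space A E = scale_space A E 1 \<times> UNIV"

definition phase_norm ::
  "'a::complex_hilbert_space opr \<Rightarrow> (real set \<Rightarrow> 'a \<Rightarrow> 'a) \<Rightarrow> 'a \<times> 'a \<Rightarrow> real" where
  "phase_norm A E p = sqrt ((scale_norm A E 1 (fst p))\<^sup>2 + (norm (snd p))\<^sup>2)"

text \<open>\<open>A u + f(A) v = h\<close> in the sense of duality.\<close>

definition weak_sum ::
  "'a::complex_hilbert_space opr \<Rightarrow> 'a opr \<Rightarrow> 'a \<Rightarrow> 'a \<Rightarrow> 'a \<Rightarrow> bool" where
  "weak_sum A F u v h \<longleftrightarrow>
     (\<forall>w \<in> op_dom A \<inter> op_dom F.
        cinner (op_app A w) u + cinner (op_app F w) v = cinner w h)"

definition damped_opr ::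
  "'a::complex_hilbert_space opr \<Rightarrow> (real set \<Rightarrow> 'a \<Rightarrow> 'a) \<Rightarrow> (real \<Rightarrow> real) \<Rightarrow> ('a \<times> 'a) opr" where
  "damped_opr A E f =
     ({(u, v). (u, v) \<in> phase_space A E \<and> v \<in> scale_space A E 1 \<and>
               (\<exists>h. weak_sum A (func_calc A E f) u v h)},
      \<lambda>(u, v). (v, - (THE h. weak_sum A (func_calc A E f) u v h)))"


section \<open>Description of the spectrum\<close>

definition xi_plus :: "(real \<Rightarrow> real) \<Rightarrow> real \<Rightarrow> complex" where
  "xi_plus f s =
     (if f s \<ge> 2 * sqrt s
      then complex_of_real (- f s / 2 + sqrt ((f s)\<^sup>2 - 4 * s) / 2)
      else complex_of_real (- f s / 2) + \<i> * complex_of_real (sqrt (4 * s - (f s)\<^sup>2) / 2))"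

definition xi_minus :: "(real \<Rightarrow> real) \<Rightarrow> real \<Rightarrow> complex" where
  "xi_minus f s =
     (if f s \<ge> 2 * sqrt s
      then complex_of_real (- f s / 2 - sqrt ((f s)\<^sup>2 - 4 * s) / 2)
      else complex_of_real (- f s / 2) - \<i> * complex_of_real (sqrt (4 * s - (f s)\<^sup>2) / 2))"

definition limit_ratios :: "real set \<Rightarrow> (real \<Rightarrow> real) \<Rightarrow> real set" where
  "limit_ratios S f =
     {l. l > 0 \<and> (\<exists>s :: nat \<Rightarrow> real. (\<forall>n. s n \<in> S) \<and> filterlim s at_top sequentially \<and>
           (\<lambda>n. f (s n) / s n) \<longlonglongrightarrow> l)}"

end

theory Submission
  imports Defs
begin

text \<open>
  On spectral coordinates \<open>z\<close> minus the damped operator is a matrix of multiplication operators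
  whose determinant is \<open>m(s) = z\<^sup>2 + z f(s) + s\<close>, with roots \<open>\<xi>\<close> in \<open>z\<close>. Its inverse is bounded in the
  energy norm as soon as \<open>|m(s)| \<ge> c (1 + s + f(s))\<close> on the spectrum of \<open>A\<close>. This bound can only
  fail at a zero of \<open>m\<close> or along \<open>s\<^sub>n \<rightarrow> \<infinity>\<close>; in the latter case, as
  \<open>m(s) / s = z\<^sup>2 / s + z f(s) / s + 1\<close>, it forces \<open>f(s\<^sub>n) / s\<^sub>n \<rightarrow> - 1 / z\<close>. Conversely, near a zero of
  \<open>m\<close> or along such a sequence there are approximate eigenvectors, since every neighbourhood of a
  point of the spectrum of \<open>A\<close> carries a nonzero spectral projection.
\<close>

section \<open>Complex Hilbert spaces\<close>

text \<open>The weight \<open>1 + s + f(s)\<close> comes from the inverse matrix. Its entries are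
  \<open>(z + f) / m\<close> from \<open>H^1\<close> to \<open>H^1\<close>, \<open>1 / m\<close>
  from \<open>H\<close> to \<open>H^1\<close>, \<open>s / m\<close> from \<open>H^1\<close> to
  \<open>H\<close> and \<open>z / m\<close> on \<open>H\<close>; measured in the energy norm their
  sizes are those of \<open>(z + f) / m\<close>, \<open>sqrt s / m\<close>,
  \<open>sqrt s / m\<close> and \<open>z / m\<close>.

  The value \<open>z = 0\<close> is special because there \<open>m(s) = s\<close>, and the lower
  bound fails as soon as \<open>f(s_n) / s_n\<close> is unbounded, a case to which no point of the
  right-hand side corresponds. For \<open>z \<noteq> 0\<close> such a sequence is harmless, since
  \<open>z f(s) / s\<close> then dominates \<open>m(s) / s\<close>.

  The points \<open>-1 / l\<close> are limits of roots: the two roots have product \<open>s\<close>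
  and sum \<open>- f(s)\<close>, so if \<open>f(s_n) / s_n\<close> tends to \<open>l\<close>, the
  root \<open>\<xi>^+\<close> behaves like \<open>- s_n / f(s_n)\<close>.

  Spectral integrals are given by polarization and a definite description on the domain. Before
  symbols can be multiplied, a functional calculus with explicit domains has to be built and
  identified with them.\<close>

lemma scaleC_zero_right [simp]: "a *\<^sub>C (0::'a::complex_vector) = 0"
  using scaleC_add_right[of a 0 "0::'a"] by simp

lemma scaleC_zero_left [simp]: "0 *\<^sub>C (x::'a::complex_vector) = 0"
  using scaleC_add_left[of 0 0 x] by simp

lemma scaleC_one [simp]: "1 *\<^sub>C (x::'a::complex_vector) = x"
  using scaleC_complex_of_real[of 1 x] by simp

lemma scaleC_minus_left: "(- a) *\<^sub>C (x::'a::complex_vector) = - (a *\<^sub>C x)"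
  using scaleC_add_left[of a "-a" x] by (simp add: minus_unique)

lemma scaleC_minus_right: "a *\<^sub>C (- x::'a::complex_vector) = - (a *\<^sub>C x)"
  using scaleC_add_right[of a x "-x"] by (simp add: minus_unique)

lemma scaleC_diff_right: "a *\<^sub>C (x - y::'a::complex_vector) = a *\<^sub>C x - a *\<^sub>C y"
  using scaleC_add_right[of a x "-y"] by (simp add: scaleC_minus_right)

lemma cinner_add_right: "cinner (x::'a::complex_hilbert_space) (y + z) = cinner x y + cinner x z"
  using cinner_add_left[of y z x] by (metis cinner_commute complex_cnj_add)

lemma cinner_scaleC_right: "cinner (x::'a::complex_hilbert_space) (a *\<^sub>C y) = cnj a * cinner x y"
  using cinner_scaleC_left[of a y x] by (metis cinner_commute complex_cnj_mult)

lemma cinner_zero_left [simp]: "cinner 0 (x::'a::complex_hilbert_space) = 0"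
  using cinner_scaleC_left[of 0 x x] by simp

lemma cinner_zero_right [simp]: "cinner (x::'a::complex_hilbert_space) 0 = 0"
  using cinner_scaleC_right[of x 0] by simp

lemma cinner_minus_left: "cinner (- (x::'a::complex_hilbert_space)) y = - cinner x y"
  using cinner_scaleC_left[of "-1" x y] by (simp add: scaleC_minus_left)

lemma cinner_minus_right: "cinner (x::'a::complex_hilbert_space) (- y) = - cinner x y"
  using cinner_scaleC_right[of x "-1" y] by (simp add: scaleC_minus_left)

lemma cinner_diff_left:
  "cinner (x - y) (z::'a::complex_hilbert_space) = cinner x z - cinner y z"
  using cinner_add_left[of x "-y" z] by (simp add: cinner_minus_left)

lemma cinner_diff_right:
  "cinner x (y - z::'a::complex_hilbert_space) = cinner x y - cinner x z"
  using cinner_add_right[of x y "-z"] by (simp add: cinner_minus_right)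

lemma norm_scaleC: "norm (a *\<^sub>C (x::'a::complex_hilbert_space)) = cmod a * norm x"
proof -
  have "cinner (a *\<^sub>C x) (a *\<^sub>C x) = (a * cnj a) * cinner x x"
    by (simp add: cinner_scaleC_left cinner_scaleC_right)
  then have "complex_of_real ((norm (a *\<^sub>C x))\<^sup>2) = complex_of_real ((cmod a * norm x)\<^sup>2)"
    by (simp only: cinner_self complex_norm_square[symmetric] power_mult_distrib of_real_mult)
  then have "(norm (a *\<^sub>C x))\<^sup>2 = (cmod a * norm x)\<^sup>2"
    by (simp only: of_real_eq_iff)
  then show ?thesis
    by (simp add: power2_eq_iff_nonneg)
qed

lemma borel_measurable_cnj [measurable (raw)]:
  "g \<in> borel_measurable M \<Longrightarrow> (\<lambda>s. cnj (g s)) \<in> borel_measurable M"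
  by (rule borel_measurable_continuous_on[OF continuous_on_cnj[OF continuous_on_id]])

text \<open>In the expansion at \<open>x + \<i> ^ k *\<^sub>C y\<close> the terms
  \<open>Q x x\<close> and \<open>Q y y\<close> get the weight \<open>\<i> ^ k\<close> and
  \<open>Q y x\<close> the weight \<open>\<i> ^ (2 * k)\<close>, which sum to zero over
  \<open>k < 4\<close>. The term \<open>Q x y\<close> carries \<open>cnj (\<i> ^ k)\<close>, which
  cancels the weight, and survives four times.\<close>

lemma polarization_form:
  fixes Q :: "'a::complex_vector \<Rightarrow> 'a \<Rightarrow> complex"
  assumes addl: "\<And>x y w. Q (x + y) w = Q x w + Q y w"
  and addr: "\<And>x y w. Q w (x + y) = Q w x + Q w y"
  and scl: "\<And>a x w. Q (a *\<^sub>C x) w = a * Q x w"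
  and scr: "\<And>a x w. Q w (a *\<^sub>C x) = cnj a * Q w x"
  shows "Q x y = (\<Sum>k<4. \<i> ^ k * Q (x + \<i> ^ k *\<^sub>C y) (x + \<i> ^ k *\<^sub>C y)) / 4"
  by (simp add: eval_nat_numeral assms algebra_simps)

lemma tendsto_scaleC [tendsto_intros]:
  fixes g :: "'b \<Rightarrow> 'a::complex_hilbert_space"
  assumes "(g \<longlongrightarrow> x) F"
  shows "((\<lambda>n. a *\<^sub>C g n) \<longlongrightarrow> a *\<^sub>C x) F"
proof -
  have "((\<lambda>n. cmod a * norm (g n - x)) \<longlongrightarrow> cmod a * 0) F"
    using assms by (intro tendsto_intros) (simp add: tendsto_norm_zero_iff LIM_zero_iff)
  then have "((\<lambda>n. a *\<^sub>C g n - a *\<^sub>C x) \<longlongrightarrow> 0) F"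
    by (subst tendsto_norm_zero_iff[symmetric])
       (simp add: norm_scaleC flip: scaleC_diff_right)
  then show ?thesis
    by (simp add: LIM_zero_iff)
qed

text \<open>Continuity of the inner product follows from polarization, without Cauchy-Schwarz.\<close>

lemma tendsto_cinner [tendsto_intros]:
  fixes g h :: "'b \<Rightarrow> 'a::complex_hilbert_space"
  assumes "(g \<longlongrightarrow> x) F" "(h \<longlongrightarrow> y) F"
  shows "((\<lambda>n. cinner (g n) (h n)) \<longlongrightarrow> cinner x y) F"
proof -
  have pol: "cinner u v =
      (\<Sum>k<4. \<i> ^ k * complex_of_real ((norm (u + \<i> ^ k *\<^sub>C v))\<^sup>2)) / 4" for u v :: 'a
    using polarization_form[of cinner u v]
    by (simp add: cinner_add_left cinner_add_right cinner_scaleC_left cinner_scaleC_right cinner_self)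
  show ?thesis
    unfolding pol by (intro tendsto_intros assms) auto
qed

text \<open>A triangle inequality for squared norms, the quantities that scalar measures and square
  integrability deal with.\<close>

lemma norm_add_sq_le: "(norm (x + y :: 'a::real_normed_vector))\<^sup>2 \<le> 2 * (norm x)\<^sup>2 + 2 * (norm y)\<^sup>2"
proof -
  have "(norm (x + y))\<^sup>2 \<le> (norm x + norm y)\<^sup>2"
    by (simp add: norm_triangle_ineq power_mono)
  also have "\<dots> \<le> 2 * (norm x)\<^sup>2 + 2 * (norm y)\<^sup>2"
    using sum_squares_bound[of "norm x" "norm y"] by (simp add: power2_sum)
  finally show ?thesis .
qed

section \<open>Functional calculus of a projection-valued measure\<close>

locale pvm =
  fixes E :: "real set \<Rightarrow> 'a::complex_hilbert_space \<Rightarrow> 'a"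
  assumes pvm: "projection_valued_measure E"
begin

lemma E_proj: "B \<in> sets borel \<Longrightarrow> orthogonal_projection (E B)"
  using pvm unfolding projection_valued_measure_def by auto

lemma E_add: "B \<in> sets borel \<Longrightarrow> E B (x + y) = E B x + E B y"
  using E_proj unfolding orthogonal_projection_def linear_opr_def op_dom_def op_app_def by auto

lemma E_scaleC: "B \<in> sets borel \<Longrightarrow> E B (a *\<^sub>C x) = a *\<^sub>C E B x"
  using E_proj unfolding orthogonal_projection_def linear_opr_def op_dom_def op_app_def by auto

lemma E_zero: "B \<in> sets borel \<Longrightarrow> E B 0 = 0"
  using E_scaleC[of B 0 0] by simp

lemma E_UNIV [simp]: "E UNIV x = x"
  using pvm unfolding projection_valued_measure_def by auto

lemma E_E: "B \<in> sets borel \<Longrightarrow> C \<in> sets borel \<Longrightarrow> E B (E C x) = E (B \<inter> C) x"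
  using pvm unfolding projection_valued_measure_def by auto

lemma E_cinner: "B \<in> sets borel \<Longrightarrow> cinner (E B x) y = cinner x (E B y)"
  using E_proj unfolding orthogonal_projection_def by auto

lemma E_sums: "range B \<subseteq> sets borel \<Longrightarrow> disjoint_family B \<Longrightarrow> (\<lambda>n. E (B n) x) sums E (\<Union>n. B n) x"
  using pvm unfolding projection_valued_measure_def by auto

text \<open>Countable additivity over empty sets makes the constant sequence \<open>E {} x\<close>
  summable, so its value is zero.\<close>

lemma E_empty [simp]: "E {} x = 0"
proof -
  have "(\<lambda>n::nat. E {} x) sums E (\<Union>n::nat. {}) x"
    using E_sums[of "\<lambda>n. {}" x] by (simp add: disjoint_family_on_def)
  then have "(\<lambda>n::nat. E {} x) \<longlonglongrightarrow> 0"
    by (intro summable_LIMSEQ_zero) (auto simp: sums_iff)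
  then show ?thesis
    by (simp add: LIMSEQ_const_iff)
qed

lemma E_cinner_self: "B \<in> sets borel \<Longrightarrow> cinner (E B x) x = complex_of_real ((norm (E B x))\<^sup>2)"
  using E_E[of B B x] E_cinner[of B "E B x" x] by (simp add: cinner_self)

section \<open>Scalar measures of a vector\<close>

abbreviation \<mu> :: "'a \<Rightarrow> real measure" where
  "\<mu> x \<equiv> scalar_measure E x"

lemma sets_\<mu> [simp, measurable_cong]: "sets (\<mu> x) = sets borel"
  unfolding scalar_measure_def using sets.sigma_sets_eq[of "borel :: real measure"] by simp

lemma space_\<mu> [simp]: "space (\<mu> x) = UNIV"
  unfolding scalar_measure_def by (simp add: space_measure_of_conv)

text \<open>\<open>measure_of\<close> takes the prescribed values only once they are known to be
  countably additive. This follows from the norm convergence of the sums of projections and the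
  continuity of the inner product.\<close>

lemma emeasure_\<mu>: "B \<in> sets borel \<Longrightarrow> emeasure (\<mu> x) B = ennreal ((norm (E B x))\<^sup>2)"
proof -
  assume B: "B \<in> sets borel"
  have eq: "ennreal (Re (cinner (E C x) x)) = ennreal ((norm (E C x))\<^sup>2)" if "C \<in> sets borel" for C
    using E_cinner_self[OF that] by simp
  have "emeasure (\<mu> x) B = ennreal (Re (cinner (E B x) x))"
  proof (rule emeasure_measure_of[OF scalar_measure_def])
    show "positive (sets (\<mu> x)) (\<lambda>B. ennreal (Re (cinner (E B x) x)))"
      by (simp add: positive_def)
    show "countably_additive (sets (\<mu> x)) (\<lambda>B. ennreal (Re (cinner (E B x) x)))"
    proof (rule countably_additiveI)
      fix C :: "nat \<Rightarrow> real set"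
      assume C: "range C \<subseteq> sets (\<mu> x)" "disjoint_family C" "(\<Union>i. C i) \<in> sets (\<mu> x)"
      have "(\<lambda>n. E (C n) x) sums E (\<Union>n. C n) x"
        using C by (intro E_sums) auto
      then have "(\<lambda>n. cinner (\<Sum>i<n. E (C i) x) x) \<longlonglongrightarrow> cinner (E (\<Union>n. C n) x) x"
        unfolding sums_def by (intro tendsto_intros)
      moreover have "cinner (\<Sum>i<n. E (C i) x) x = (\<Sum>i<n. cinner (E (C i) x) x)" for n
        by (induction n) (auto simp: cinner_add_left)
      ultimately have "(\<lambda>n. cinner (E (C n) x) x) sums cinner (E (\<Union>n. C n) x) x"
        unfolding sums_def by simp
      then have s: "(\<lambda>n. Re (cinner (E (C n) x) x)) sums Re (cinner (E (\<Union>n. C n) x) x)"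
        by (rule sums_Re)
      have "Re (cinner (E (C n) x) x) \<ge> 0" for n
        using C by (subst E_cinner_self) auto
      with s show "(\<Sum>i. ennreal (Re (cinner (E (C i) x) x))) = ennreal (Re (cinner (E (\<Union>n. C n) x) x))"
        by (subst suminf_ennreal2) (auto simp: sums_iff)
    qed
  qed (use B in auto)
  then show ?thesis
    using eq B by simp
qed

lemma finite_\<mu>: "finite_measure (\<mu> x)"
  by (rule finite_measureI) (simp add: emeasure_\<mu>)

lemma measure_\<mu>: "B \<in> sets borel \<Longrightarrow> measure (\<mu> x) B = (norm (E B x))\<^sup>2"
  by (simp add: measure_def emeasure_\<mu>)

text \<open>Monotonicity of the scalar measure: the mass of \<open>B\<close> is at most the total
  mass, which is the squared norm of \<open>x\<close>.\<close>

lemma norm_E_le: "B \<in> sets borel \<Longrightarrow> norm (E B x) \<le> norm x"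
  using finite_measure.bounded_measure[OF finite_\<mu>, of x B]
  by (simp add: measure_\<mu> power2_le_iff_abs_le)

lemma tendsto_E: "B \<in> sets borel \<Longrightarrow> (g \<longlongrightarrow> x) F \<Longrightarrow> ((\<lambda>n. E B (g n)) \<longlongrightarrow> E B x) F"
proof -
  assume B: "B \<in> sets borel" and g: "(g \<longlongrightarrow> x) F"
  have d: "E B (u - v) = E B u - E B v" for u v
    using E_add[OF B, of "u - v" v] by simp
  have "((\<lambda>n. E B (g n) - E B x) \<longlongrightarrow> 0) F"
    by (rule Lim_null_comparison[of _ "\<lambda>n. norm (g n - x)"])
       (use g norm_E_le[OF B] in \<open>auto simp: d[symmetric] tendsto_norm_zero_iff LIM_zero_iff\<close>)
  then show ?thesis
    by (simp add: LIM_zero_iff)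
qed

text \<open>
  A step function is a list of coefficients and Borel sets. The sets may overlap, so that
  sums of step functions are concatenations of lists.
\<close>

definition blist :: "(complex \<times> real set) list \<Rightarrow> bool" where
  "blist l \<longleftrightarrow> (\<forall>(c, B)\<in>set l. B \<in> sets borel)"

definition step :: "(complex \<times> real set) list \<Rightarrow> real \<Rightarrow> complex" where
  "step l s = (\<Sum>(c, B)\<leftarrow>l. c * indicator B s)"

definition sop :: "(complex \<times> real set) list \<Rightarrow> 'a \<Rightarrow> 'a" where
  "sop l x = (\<Sum>(c, B)\<leftarrow>l. c *\<^sub>C E B x)"

lemma blist_simps [simp]:
  "blist []" "blist ((c, B) # l) \<longleftrightarrow> B \<in> sets borel \<and> blist l"
  "blist (l @ l') \<longleftrightarrow> blist l \<and> blist l'"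
  by (auto simp: blist_def)

lemma step_simps [simp]:
  "step [] s = 0" "step ((c, B) # l) s = c * indicator B s + step l s"
  "step (l @ l') s = step l s + step l' s"
  by (auto simp: step_def)

lemma sop_simps [simp]:
  "sop [] x = 0" "sop ((c, B) # l) x = c *\<^sub>C E B x + sop l x"
  "sop (l @ l') x = sop l x + sop l' x"
  by (auto simp: sop_def)

lemma step_measurable [measurable]: "blist l \<Longrightarrow> step l \<in> borel_measurable borel"
proof (induction l)
  case Nil
  then show ?case by (simp add: step_def[abs_def])
next
  case (Cons a l)
  obtain c B where a: "a = (c, B)" by fastforce
  with Cons have [measurable]: "B \<in> sets borel" "step l \<in> borel_measurable borel" by auto
  show ?case unfolding a step_simps(2)[abs_def] by measurable
qed

lemma step_bounded: "\<exists>K. \<forall>s. cmod (step l s) \<le> K"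
proof (induction l)
  case (Cons a l)
  obtain c B where a: "a = (c, B)" by fastforce
  from Cons obtain K where K: "\<And>s. cmod (step l s) \<le> K" by blast
  have "cmod (step (a # l) s) \<le> cmod c + K" for s
  proof -
    have "cmod (c * indicator B s) \<le> cmod c"
      by (auto simp: indicator_def)
    then show ?thesis
      unfolding a step_simps using K[of s] norm_triangle_ineq order_trans add_mono by metis
  qed
  then show ?case by blast
qed auto

lemma integrable_bounded:
  fixes g :: "real \<Rightarrow> 'b::{banach, second_countable_topology}"
  assumes [measurable]: "g \<in> borel_measurable borel" and "\<And>s. norm (g s) \<le> K"
  shows "integrable (\<mu> x) g"
  by (rule finite_measure.integrable_const_bound[OF finite_\<mu>, of _ K]) (use assms in auto)

text \<open>Both sides are sesquilinear in the two lists, so induction reduces the claim to two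
  indicators. There \<open>cinner (E B x) (E C x)\<close> is the mass of
  \<open>B \<inter> C\<close>, because the projections multiply. For \<open>k = l\<close> this is
  the isometry on which all limits rest.\<close>

lemma sop_cinner:
  assumes "blist l" "blist k"
  shows "cinner (sop l x) (sop k x) = (LINT s|\<mu> x. step l s * cnj (step k s))"
proof -
  have int: "integrable (\<mu> x) (\<lambda>s. g s * h s)"
    if "g \<in> borel_measurable borel" "h \<in> borel_measurable borel" "\<And>s. cmod (g s) \<le> K" "\<And>s. cmod (h s) \<le> K'"
    for g h :: "real \<Rightarrow> complex" and K K'
  proof (rule integrable_bounded[where K = "K * K'"])
    show "cmod (g s * h s) \<le> K * K'" for s
      unfolding norm_mult using that order_trans[OF norm_ge_zero that(3)] by (intro mult_mono) auto
  qed (use that in measurable)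
  have one: "cinner (c *\<^sub>C E B x) (sop k x) = (LINT s|\<mu> x. (c * indicator B s) * cnj (step k s))"
    if [measurable]: "B \<in> sets borel" and "blist k" for c B k
    using \<open>blist k\<close>
  proof (induction k)
    case (Cons a k)
    obtain d C where a: "a = (d, C)" by fastforce
    with Cons have C [measurable]: "C \<in> sets borel" and k: "blist k" by auto
    obtain K where K: "\<And>s. cmod (step k s) \<le> K" using step_bounded by metis
    have i1: "integrable (\<mu> x) (\<lambda>s. (c * cnj d) * complex_of_real (indicator (B \<inter> C) s))"
      by (rule integrable_bounded[where K = "cmod (c * d)"]) (auto simp: indicator_def norm_mult)
    have i2: "integrable (\<mu> x) (\<lambda>s. (c * indicator B s) * cnj (step k s))"
      using k K by (intro int[where K = "cmod c"]) (auto simp: indicator_def)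
    have "(LINT s|\<mu> x. (c * indicator B s) * cnj (step (a # k) s)) =
        (LINT s|\<mu> x. (c * cnj d) * complex_of_real (indicator (B \<inter> C) s) + (c * indicator B s) * cnj (step k s))"
      by (intro Bochner_Integration.integral_cong) (auto simp: a indicator_def algebra_simps)
    also have "\<dots> = c * cnj d * complex_of_real (measure (\<mu> x) (B \<inter> C)) + cinner (c *\<^sub>C E B x) (sop k x)"
      using i1 i2 Cons.IH[OF k]
      by (subst Bochner_Integration.integral_add) auto
    also have "c * cnj d * complex_of_real (measure (\<mu> x) (B \<inter> C)) = cinner (c *\<^sub>C E B x) (d *\<^sub>C E C x)"
      using E_E[OF C that(1), of x] E_cinner[of C "E B x" x] E_cinner_self[of "B \<inter> C" x]
      by (simp add: cinner_scaleC_left cinner_scaleC_right measure_\<mu> Int_commute)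
    finally show ?case
      by (simp add: a cinner_add_right)
  qed simp
  show ?thesis
    using assms(1)
  proof (induction l)
    case (Cons a l)
    obtain c B where a: "a = (c, B)" by fastforce
    with Cons have B [measurable]: "B \<in> sets borel" and l: "blist l" by auto
    obtain K where K: "\<And>s. cmod (step k s) \<le> K" using step_bounded by metis
    obtain L where L: "\<And>s. cmod (step l s) \<le> L" using step_bounded by metis
    have i1: "integrable (\<mu> x) (\<lambda>s. (c * indicator B s) * cnj (step k s))"
      using assms K by (intro int[where K = "cmod c"]) (auto simp: indicator_def)
    have i2: "integrable (\<mu> x) (\<lambda>s. step l s * cnj (step k s))"
      using assms K L l by (intro int[where K = L]) auto
    show ?case
      using i1 i2 Cons.IH[OF l] one[OF B assms(2)]
      by (simp add: a cinner_add_left distrib_right)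
  qed simp
qed

lemma norm_sop: "blist l \<Longrightarrow> (norm (sop l x))\<^sup>2 = (LINT s|\<mu> x. (cmod (step l s))\<^sup>2)"
proof -
  assume "blist l"
  then have "complex_of_real ((norm (sop l x))\<^sup>2) = complex_of_real (LINT s|\<mu> x. (cmod (step l s))\<^sup>2)"
    using sop_cinner[of l l x]
    by (simp only: cinner_self complex_norm_square[symmetric] of_real_power[symmetric] integral_complex_of_real)
  then show ?thesis
    by (simp only: of_real_eq_iff)
qed

definition lscale :: "complex \<Rightarrow> (complex \<times> real set) list \<Rightarrow> (complex \<times> real set) list" where
  "lscale a l = map (\<lambda>(c, B). (a * c, B)) l"

definition lcnj :: "(complex \<times> real set) list \<Rightarrow> (complex \<times> real set) list" where
  "lcnj l = map (\<lambda>(c, B). (cnj c, B)) l"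

definition lrestrict :: "real set \<Rightarrow> (complex \<times> real set) list \<Rightarrow> (complex \<times> real set) list" where
  "lrestrict C l = map (\<lambda>(c, B). (c, C \<inter> B)) l"

lemma lscale: "blist (lscale a l) = blist l" "step (lscale a l) s = a * step l s"
  "sop (lscale a l) x = a *\<^sub>C sop l x"
  by (induction l) (auto simp: lscale_def algebra_simps scaleC_add_right scaleC_scaleC)

lemma lcnj: "blist (lcnj l) = blist l" "step (lcnj l) s = cnj (step l s)"
  by (induction l) (auto simp: lcnj_def indicator_def)

lemma sop_adjoint: "blist l \<Longrightarrow> cinner (sop l x) y = cinner x (sop (lcnj l) y)"
  by (induction l) (auto simp: lcnj_def cinner_add_left cinner_add_right cinner_scaleC_left cinner_scaleC_right E_cinner)

lemma lrestrict: "C \<in> sets borel \<Longrightarrow> blist l \<Longrightarrow> blist (lrestrict C l)"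
  "step (lrestrict C l) s = indicator C s * step l s"
  "C \<in> sets borel \<Longrightarrow> blist l \<Longrightarrow> sop (lrestrict C l) x = E C (sop l x)"
  by (induction l) (auto simp: lrestrict_def indicator_def algebra_simps E_add E_scaleC E_zero E_E)

lemma sop_add: "blist l \<Longrightarrow> sop l (x + y) = sop l x + sop l y"
  by (induction l) (auto simp: E_add scaleC_add_right)

lemma sop_scaleC: "blist l \<Longrightarrow> sop l (a *\<^sub>C x) = a *\<^sub>C sop l x"
  by (induction l) (auto simp: E_scaleC scaleC_add_right scaleC_scaleC mult.commute)

lemma step_approx_ex:
  assumes "g \<in> borel_measurable borel"
  shows "\<exists>l. (\<forall>n. blist (l n)) \<and> (\<forall>s. (\<lambda>n::nat. step (l n) s) \<longlonglongrightarrow> g s) \<and>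
           (\<forall>n s. cmod (step (l n) s) \<le> 2 * cmod (g s))"
proof -
  \<comment> \<open>With base point \<open>0\<close> the distance estimate for the approximating
    simple functions becomes domination by \<open>2 * cmod (g s)\<close>, the majorant for dominated
    convergence.\<close>
  obtain F where F: "\<And>i. simple_function borel (F i)" "\<And>s. (\<lambda>i. F i s) \<longlonglongrightarrow> g s"
    "\<And>i s. cmod (F i s) \<le> 2 * cmod (g s)"
    using borel_measurable_implies_sequence_metric[OF assms, of 0] by (auto simp: dist_norm)
  have "\<exists>l. blist l \<and> (\<forall>s. step l s = F i s)" for i
  proof -
    have fin: "finite (range (F i))"
      using F(1)[of i] by (auto simp: simple_function_def)
    then obtain cs where cs: "set cs = range (F i)" "distinct cs"
      using finite_distinct_list by blast
    \<comment> \<open>Listing the range without repetitions leaves exactly one active entry at each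
      point.\<close>
    define l where "l = map (\<lambda>c. (c, F i -` {c})) cs"
    have "blist l"
      using F(1)[of i] cs by (auto simp: l_def blist_def simple_function_def)
    moreover have "step l s = F i s" for s
    proof -
      have "step l s = (\<Sum>c\<in>range (F i). c * indicator (F i -` {c}) s)"
        using cs by (simp add: step_def l_def o_def sum_list_distinct_conv_sum_set)
      also have "\<dots> = (\<Sum>c\<in>range (F i). if c = F i s then c else 0)"
        by (intro sum.cong) (auto simp: indicator_def)
      also have "\<dots> = F i s"
        using fin by simp
      finally show ?thesis .
    qed
    ultimately show ?thesis by blast
  qed
  then obtain l where "\<And>i. blist (l i)" "\<And>i s. step (l i) s = F i s"
    by metis
  with F show ?thesis
    by (intro exI[of _ l]) auto
qed

definition approx :: "(real \<Rightarrow> complex) \<Rightarrow> nat \<Rightarrow> (complex \<times> real set) list" where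
  "approx g = (SOME l. (\<forall>n. blist (l n)) \<and> (\<forall>s. (\<lambda>n::nat. step (l n) s) \<longlonglongrightarrow> g s) \<and>
           (\<forall>n s. cmod (step (l n) s) \<le> 2 * cmod (g s)))"

lemma approx:
  assumes "g \<in> borel_measurable borel"
  shows "blist (approx g n)" "(\<lambda>n. step (approx g n) s) \<longlonglongrightarrow> g s"
    "cmod (step (approx g n) s) \<le> 2 * cmod (g s)"
  using someI_ex[OF step_approx_ex[OF assms]] unfolding approx_def[symmetric] by auto

text \<open>
  The functional calculus. The approximating step functions do not depend on the vector, so
  linearity in the vector is inherited from step functions.
\<close>

definition fc :: "(real \<Rightarrow> complex) \<Rightarrow> 'a \<Rightarrow> 'a" where
  "fc g x = lim (\<lambda>n. sop (approx g n) x)"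

text \<open>Says that \<open>x\<close> lies in the domain of the operator with symbol
  \<open>g\<close>; for real symbols this is the domain condition of
  \<open>spectral_integral\<close>.\<close>

definition L2 :: "'a \<Rightarrow> (real \<Rightarrow> complex) \<Rightarrow> bool" where
  "L2 x g \<longleftrightarrow> g \<in> borel_measurable borel \<and> integrable (\<mu> x) (\<lambda>s. (cmod (g s))\<^sup>2)"

lemma L2_measurable [measurable_dest]: "L2 x g \<Longrightarrow> g \<in> borel_measurable borel"
  by (simp add: L2_def)

lemma L2_mono:
  assumes "L2 x w" "g \<in> borel_measurable borel" "\<And>s. cmod (g s) \<le> K * cmod (w s)"
  shows "L2 x g"
proof -
  have [measurable]: "w \<in> borel_measurable borel" "g \<in> borel_measurable borel"
    using assms by (auto simp: L2_def)
  have "integrable (\<mu> x) (\<lambda>s. K\<^sup>2 * (cmod (w s))\<^sup>2)"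
    using assms by (simp add: L2_def)
  then have "integrable (\<mu> x) (\<lambda>s. (cmod (g s))\<^sup>2)"
  proof (rule Bochner_Integration.integrable_bound)
    show "AE s in \<mu> x. norm ((cmod (g s))\<^sup>2) \<le> norm (K\<^sup>2 * (cmod (w s))\<^sup>2)"
    proof (intro AE_I2)
      fix s show "norm ((cmod (g s))\<^sup>2) \<le> norm (K\<^sup>2 * (cmod (w s))\<^sup>2)"
        using power_mono[OF assms(3)[of s], of 2] by (simp add: power_mult_distrib)
    qed
  qed measurable
  then show ?thesis
    using assms by (simp add: L2_def)
qed

lemma L2_add:
  assumes "L2 x g" "L2 x h"
  shows "L2 x (\<lambda>s. g s + h s)"
proof -
  have [measurable]: "g \<in> borel_measurable borel" "h \<in> borel_measurable borel"
    using assms by (auto simp: L2_def)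
  have "integrable (\<mu> x) (\<lambda>s. 2 * (cmod (g s))\<^sup>2 + 2 * (cmod (h s))\<^sup>2)"
    using assms by (simp add: L2_def)
  then have "integrable (\<mu> x) (\<lambda>s. (cmod (g s + h s))\<^sup>2)"
    by (rule Bochner_Integration.integrable_bound)
       (auto intro!: AE_I2 order_trans[OF norm_add_sq_le])
  then show ?thesis
    by (simp add: L2_def)
qed

lemma L2_scale: "L2 x g \<Longrightarrow> L2 x (\<lambda>s. a * g s)"
  by (rule L2_mono[of x g _ "cmod a"]) (auto simp: norm_mult)

lemma L2_cmod: "L2 x g \<Longrightarrow> L2 x (\<lambda>s. complex_of_real (cmod (g s)))"
  by (rule L2_mono[of x g _ 1]) auto

lemma L2_const: "L2 x (\<lambda>s. c)"
  using finite_measure.integrable_const[OF finite_\<mu>] by (simp add: L2_def)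

lemma L2_bounded:
  assumes "g \<in> borel_measurable borel" "\<And>s. cmod (g s) \<le> K"
  shows "L2 x g"
  by (rule L2_mono[OF L2_const[of x 1], of _ K]) (use assms in auto)

lemma L2_indicator: "L2 x g \<Longrightarrow> B \<in> sets borel \<Longrightarrow> L2 x (\<lambda>s. indicator B s * g s)"
  by (rule L2_mono[of x g _ 1]) (auto simp: indicator_def)

text \<open>A common majorant for a step sequence dominated by one symbol and the approximants of
  another; it is cast back to the complex numbers so that it is again a symbol.\<close>

lemma L2_dominator:
  assumes "L2 x g" "L2 x h"
  shows "L2 x (\<lambda>s. complex_of_real (cmod (g s) + c * cmod (h s)))"
  using L2_add[OF L2_cmod[OF assms(1)] L2_scale[OF L2_cmod[OF assms(2)], of "of_real c"]] by simp

lemma L2_dominated_convergence: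
  assumes "L2 x w" "\<And>n. g n \<in> borel_measurable borel" "k \<in> borel_measurable borel"
    and lim: "\<And>s. (\<lambda>n. g n s) \<longlonglongrightarrow> k s" and dom: "\<And>n s. cmod (g n s) \<le> cmod (w s)"
  shows "(\<lambda>n. LINT s|\<mu> x. (cmod (g n s))\<^sup>2) \<longlonglongrightarrow> (LINT s|\<mu> x. (cmod (k s))\<^sup>2)"
proof (rule integral_dominated_convergence[where w = "\<lambda>s. (cmod (w s))\<^sup>2"])
  have [measurable]: "w \<in> borel_measurable borel" "k \<in> borel_measurable borel" "\<And>n. g n \<in> borel_measurable borel"
    using assms by (auto simp: L2_def)
  show "(\<lambda>s. (cmod (k s))\<^sup>2) \<in> borel_measurable (\<mu> x)" "\<And>n. (\<lambda>s. (cmod (g n s))\<^sup>2) \<in> borel_measurable (\<mu> x)"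
    by measurable
  show "integrable (\<mu> x) (\<lambda>s. (cmod (w s))\<^sup>2)"
    using assms by (simp add: L2_def)
  show "AE s in \<mu> x. (\<lambda>n. (cmod (g n s))\<^sup>2) \<longlonglongrightarrow> (cmod (k s))\<^sup>2"
    by (intro AE_I2 tendsto_intros lim)
  show "AE s in \<mu> x. norm ((cmod (g n s))\<^sup>2) \<le> (cmod (w s))\<^sup>2" for n
    by (auto intro!: AE_I2 power_mono dom)
qed

lemma sop_tendsto_zero:
  assumes "L2 x w" "\<And>n. blist (l n)" "\<And>s. (\<lambda>n. step (l n) s) \<longlonglongrightarrow> 0" "\<And>n s. cmod (step (l n) s) \<le> cmod (w s)"
  shows "(\<lambda>n. sop (l n) x) \<longlonglongrightarrow> 0"
proof -
  have "(\<lambda>n. (norm (sop (l n) x))\<^sup>2) \<longlonglongrightarrow> (LINT s|\<mu> x. (cmod 0)\<^sup>2)"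
    unfolding norm_sop[OF assms(2)] using assms
    by (intro L2_dominated_convergence[of x w]) auto
  then have "(\<lambda>n. sqrt ((norm (sop (l n) x))\<^sup>2)) \<longlonglongrightarrow> sqrt 0"
    by (intro tendsto_intros) simp
  then show ?thesis
    by (simp add: tendsto_norm_zero_iff)
qed

text \<open>By the isometry, convergence of the approximants in the mean square makes their
  operators a Cauchy sequence at \<open>x\<close>; completeness of the space provides the
  limit.\<close>

lemma sop_approx_tendsto:
  assumes "L2 x g"
  shows "(\<lambda>n. sop (approx g n) x) \<longlonglongrightarrow> fc g x"
proof -
  have [measurable]: "g \<in> borel_measurable borel"
    using assms by (simp add: L2_def)
  note a = approx[OF this]
  define e where "e n = (LINT s|\<mu> x. (cmod (step (approx g n) s - g s))\<^sup>2)" for n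
  \<comment> \<open>The factor 3 is the factor 2 of the approximants plus 1 for \<open>g\<close>
    itself.\<close>
  have w: "L2 x (\<lambda>s. 3 * g s)"
    using L2_scale[OF assms] by auto
  have d3: "cmod (step (approx g n) s - g s) \<le> cmod (3 * g s)" for n s
    using norm_triangle_ineq4[of "step (approx g n) s" "g s"] a(3)[of n s] by (simp add: norm_mult)
  have "e \<longlonglongrightarrow> (LINT s|\<mu> x. (cmod 0)\<^sup>2)"
    unfolding e_def using a d3 LIM_zero[OF a(2)]
    by (intro L2_dominated_convergence[OF w]) auto
  then have e0: "e \<longlonglongrightarrow> 0"
    by simp
  have dL: "L2 x (\<lambda>s. step (approx g n) s - g s)" for n
    by (rule L2_mono[OF w, of _ 1]) (use a d3 in auto)
  have le: "(norm (sop (approx g m) x - sop (approx g n) x))\<^sup>2 \<le> 2 * e m + 2 * e n" for m n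
  proof -
    \<comment> \<open>The difference is the operator of a concatenated list, so the isometry applies
      to it.\<close>
    have eq: "sop (approx g m) x - sop (approx g n) x = sop (approx g m @ lscale (-1) (approx g n)) x"
      by (simp add: lscale scaleC_minus_left)
    have "(norm (sop (approx g m) x - sop (approx g n) x))\<^sup>2 =
       (LINT s|\<mu> x. (cmod ((step (approx g m) s - g s) + - (step (approx g n) s - g s)))\<^sup>2)"
      using a unfolding eq by (subst norm_sop) (auto simp: lscale)
    also have "\<dots> \<le> (LINT s|\<mu> x. 2 * (cmod (step (approx g m) s - g s))\<^sup>2 + 2 * (cmod (step (approx g n) s - g s))\<^sup>2)"
    proof (rule integral_mono)
      show "integrable (\<mu> x) (\<lambda>s. (cmod (step (approx g m) s - g s + - (step (approx g n) s - g s)))\<^sup>2)"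
        using L2_add[OF dL[of m] L2_scale[OF dL[of n], of "-1"]] by (simp add: L2_def)
      show "(cmod (step (approx g m) s - g s + - (step (approx g n) s - g s)))\<^sup>2
          \<le> 2 * (cmod (step (approx g m) s - g s))\<^sup>2 + 2 * (cmod (step (approx g n) s - g s))\<^sup>2" for s
        using norm_add_sq_le[of "step (approx g m) s - g s" "- (step (approx g n) s - g s)"]
        by (simp only: norm_minus_cancel)
    qed (use dL in \<open>auto simp: L2_def\<close>)
    also have "\<dots> = 2 * e m + 2 * e n"
      using dL unfolding e_def L2_def by simp
    finally show ?thesis .
  qed
  have "Cauchy (\<lambda>n. sop (approx g n) x)"
  proof (rule CauchyI)
    fix r :: real assume r: "0 < r"
    then obtain N where N: "\<And>n. n \<ge> N \<Longrightarrow> e n < r\<^sup>2 / 4"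
      using order_tendstoD(2)[OF e0, of "r\<^sup>2 / 4"] by (auto simp: eventually_sequentially)
    have "norm (sop (approx g m) x - sop (approx g n) x) < r" if "m \<ge> N" "n \<ge> N" for m n
    proof (rule power2_less_imp_less)
      show "(norm (sop (approx g m) x - sop (approx g n) x))\<^sup>2 < r\<^sup>2"
        using le[of m n] N[OF that(1)] N[OF that(2)] by linarith
    qed (use r in simp)
    then show "\<exists>M. \<forall>m\<ge>M. \<forall>n\<ge>M. norm (sop (approx g m) x - sop (approx g n) x) < r"
      by blast
  qed
  then show ?thesis
    unfolding fc_def by (simp add: Cauchy_convergent_iff convergent_LIMSEQ_iff)
qed

text \<open>The limit does not depend on the chosen approximants: any dominated, pointwise
  convergent sequence of step functions differs from them by one that tends to zero. The rules for
  multiples, sums, restrictions and adjoints below are proved by exhibiting such a sequence.\<close>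

lemma fc_limit:
  assumes "L2 x g" "L2 x w" "\<And>n. blist (l n)" "\<And>s. (\<lambda>n. step (l n) s) \<longlonglongrightarrow> g s"
    "\<And>n s. cmod (step (l n) s) \<le> cmod (w s)"
  shows "(\<lambda>n. sop (l n) x) \<longlonglongrightarrow> fc g x"
proof -
  have "g \<in> borel_measurable borel"
    using assms by (simp add: L2_def)
  note a = approx[OF this]
  have "(\<lambda>n. sop (l n @ lscale (-1) (approx g n)) x) \<longlonglongrightarrow> 0"
  proof (rule sop_tendsto_zero[OF L2_dominator[OF assms(2,1), of 2]])
    show "blist (l n @ lscale (- 1) (approx g n))" for n
      using a assms by (simp add: lscale)
    show "(\<lambda>n. step (l n @ lscale (- 1) (approx g n)) s) \<longlonglongrightarrow> 0" for s
      using tendsto_diff[OF assms(4)[of s] a(2)[of s]] by (simp add: lscale)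
    show "cmod (step (l n @ lscale (- 1) (approx g n)) s) \<le> cmod (complex_of_real (cmod (w s) + 2 * cmod (g s)))" for n s
      using norm_triangle_ineq4[of "step (l n) s" "step (approx g n) s"] a(3)[of n s] assms(5)[of n s]
      by (simp add: lscale del: of_real_add)
  qed
  then have "(\<lambda>n. (sop (l n) x - sop (approx g n) x) + sop (approx g n) x) \<longlonglongrightarrow> 0 + fc g x"
    by (intro tendsto_intros sop_approx_tendsto assms) (simp add: lscale scaleC_minus_left)
  then show ?thesis
    by simp
qed

section \<open>Rules of the calculus in the symbol\<close>

lemma fc_step: "blist l \<Longrightarrow> fc (step l) x = sop l x"
proof -
  assume l: "blist l"
  then have "L2 x (step l)"
    using step_bounded[of l] L2_bounded[of "step l"] by auto
  from fc_limit[OF this this, of "\<lambda>_. l"] l show ?thesis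
    by (simp add: LIMSEQ_const_iff)
qed

lemma fc_indicator: "B \<in> sets borel \<Longrightarrow> fc (indicator B) x = E B x"
  using fc_step[of "[(1, B)]" x] by (simp add: step_def[abs_def])

lemma fc_one: "fc (\<lambda>s. 1) x = x"
  using fc_step[of "[(1, UNIV)]" x] by (simp add: step_def[abs_def])

lemma norm_fc:
  assumes "L2 x g"
  shows "(norm (fc g x))\<^sup>2 = (LINT s|\<mu> x. (cmod (g s))\<^sup>2)"
proof -
  have g: "g \<in> borel_measurable borel"
    using assms by (simp add: L2_def)
  note a = approx[OF this]
  have "(\<lambda>n. (norm (sop (approx g n) x))\<^sup>2) \<longlonglongrightarrow> (norm (fc g x))\<^sup>2"
    by (intro tendsto_intros sop_approx_tendsto assms)
  moreover have "(\<lambda>n. (norm (sop (approx g n) x))\<^sup>2) \<longlonglongrightarrow> (LINT s|\<mu> x. (cmod (g s))\<^sup>2)"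
    unfolding norm_sop[OF a(1)]
    by (rule L2_dominated_convergence[OF L2_scale[OF assms, of 2]]) (use a g in \<open>auto simp: norm_mult\<close>)
  ultimately show ?thesis
    by (rule LIMSEQ_unique)
qed

lemma fc_cinner_self:
  assumes "L2 x g"
  shows "cinner (fc g x) x = (LINT s|\<mu> x. g s)"
proof -
  have g [measurable]: "g \<in> borel_measurable borel"
    using assms by (simp add: L2_def)
  note a = approx[OF this]
  have "(\<lambda>n. cinner (sop (approx g n) x) x) \<longlonglongrightarrow> cinner (fc g x) x"
    by (intro tendsto_intros sop_approx_tendsto assms)
  moreover have "(\<lambda>n. LINT s|\<mu> x. step (approx g n) s) \<longlonglongrightarrow> (LINT s|\<mu> x. g s)"
  proof (rule integral_dominated_convergence[where w = "\<lambda>s. 2 * cmod (g s)"])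
    \<comment> \<open>The measure is finite, so square integrability implies integrability through
      \<open>2 * t \<le> 1 + t\<^sup>2\<close>.\<close>
    have "integrable (\<mu> x) (\<lambda>s. 1 + (cmod (g s))\<^sup>2)"
      using assms finite_measure.integrable_const[OF finite_\<mu>, of x "1::real"]
      by (intro Bochner_Integration.integrable_add) (auto simp: L2_def)
    then show "integrable (\<mu> x) (\<lambda>s. 2 * cmod (g s))"
    proof (rule Bochner_Integration.integrable_bound)
      have "2 * t \<le> 1 + t\<^sup>2" for t :: real
        using sum_squares_bound[of 1 t] by simp
      then show "AE s in \<mu> x. norm (2 * cmod (g s)) \<le> norm (1 + (cmod (g s))\<^sup>2)"
        by (intro AE_I2) (simp add: add_nonneg_nonneg)
    qed measurable
  qed (use a in auto)
  moreover have "cinner (sop l x) x = (LINT s|\<mu> x. step l s)" if "blist l" for l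
    using sop_cinner[OF that, of "[(1, UNIV)]" x] by simp
  ultimately show ?thesis
    using a by (simp add: LIMSEQ_unique)
qed

lemma fc_scale:
  assumes "L2 x g"
  shows "fc (\<lambda>s. a * g s) x = a *\<^sub>C fc g x"
proof -
  have "g \<in> borel_measurable borel"
    using assms by (simp add: L2_def)
  note ap = approx[OF this]
  have "(\<lambda>n. sop (lscale a (approx g n)) x) \<longlonglongrightarrow> fc (\<lambda>s. a * g s) x"
  proof (rule fc_limit[OF L2_scale[OF assms] L2_scale[OF assms, of "2 * a"]])
    show "(\<lambda>n. step (lscale a (approx g n)) s) \<longlonglongrightarrow> a * g s" for s
      unfolding lscale by (intro tendsto_intros ap)
    show "cmod (step (lscale a (approx g n)) s) \<le> cmod (2 * a * g s)" for n s
      using mult_left_mono[OF ap(3)[of n s], of "cmod a"] by (simp add: lscale norm_mult ac_simps)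
  qed (use ap in \<open>auto simp: lscale\<close>)
  moreover have "(\<lambda>n. sop (lscale a (approx g n)) x) \<longlonglongrightarrow> a *\<^sub>C fc g x"
    unfolding lscale by (intro tendsto_intros sop_approx_tendsto assms)
  ultimately show ?thesis
    by (rule LIMSEQ_unique)
qed

lemma fc_add:
  assumes "L2 x g" "L2 x h"
  shows "fc (\<lambda>s. g s + h s) x = fc g x + fc h x"
proof -
  have "g \<in> borel_measurable borel" "h \<in> borel_measurable borel"
    using assms by (auto simp: L2_def)
  note ap = approx[OF this(1)] approx[OF this(2)]
  have "(\<lambda>n. sop (approx g n @ approx h n) x) \<longlonglongrightarrow> fc (\<lambda>s. g s + h s) x"
  proof (rule fc_limit[OF L2_add[OF assms] L2_scale[OF L2_dominator[OF assms, of 1], of 2]])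
    show "(\<lambda>n. step (approx g n @ approx h n) s) \<longlonglongrightarrow> g s + h s" for s
      unfolding step_simps by (intro tendsto_intros ap)
    show "cmod (step (approx g n @ approx h n) s) \<le> cmod (2 * complex_of_real (cmod (g s) + 1 * cmod (h s)))" for n s
      using norm_triangle_mono[OF ap(3)[of n s] ap(6)[of n s]]
      by (simp add: norm_mult flip: of_real_add)
  qed (use ap in auto)
  moreover have "(\<lambda>n. sop (approx g n @ approx h n) x) \<longlonglongrightarrow> fc g x + fc h x"
    unfolding sop_simps by (intro tendsto_intros sop_approx_tendsto assms)
  ultimately show ?thesis
    by (rule LIMSEQ_unique)
qed

lemma fc_diff:
  assumes "L2 x g" "L2 x h"
  shows "fc (\<lambda>s. g s - h s) x = fc g x - fc h x"
  using fc_add[OF assms(1) L2_scale[OF assms(2), of "-1"]] fc_scale[OF assms(2), of "-1"]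
  by (simp add: scaleC_minus_left)

lemma E_fc:
  assumes "L2 x g" "B \<in> sets borel"
  shows "E B (fc g x) = fc (\<lambda>s. indicator B s * g s) x"
proof -
  have "g \<in> borel_measurable borel"
    using assms by (auto simp: L2_def)
  note ap = approx[OF this]
  have "(\<lambda>n. sop (lrestrict B (approx g n)) x) \<longlonglongrightarrow> fc (\<lambda>s. indicator B s * g s) x"
  proof (rule fc_limit[OF L2_indicator[OF assms] L2_scale[OF assms(1), of 2]])
    show "(\<lambda>n. step (lrestrict B (approx g n)) s) \<longlonglongrightarrow> indicator B s * g s" for s
      unfolding lrestrict(2) by (intro tendsto_intros ap)
    show "cmod (step (lrestrict B (approx g n)) s) \<le> cmod (2 * g s)" for n s
      using ap(3)[of n s] by (auto simp: lrestrict(2) indicator_def norm_mult)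
  qed (use ap assms in \<open>auto simp: lrestrict\<close>)
  moreover have "(\<lambda>n. sop (lrestrict B (approx g n)) x) \<longlonglongrightarrow> E B (fc g x)"
    unfolding lrestrict(3)[OF assms(2) ap(1)] by (intro tendsto_E sop_approx_tendsto assms)
  ultimately show ?thesis
    using LIMSEQ_unique by blast
qed

lemma fc_adjoint:
  assumes "L2 x g" "L2 y (\<lambda>s. cnj (g s))"
  shows "cinner (fc g x) y = cinner x (fc (\<lambda>s. cnj (g s)) y)"
proof -
  have "g \<in> borel_measurable borel"
    using assms by (auto simp: L2_def)
  note ap = approx[OF this]
  have "(\<lambda>n. sop (lcnj (approx g n)) y) \<longlonglongrightarrow> fc (\<lambda>s. cnj (g s)) y"
  proof (rule fc_limit[OF assms(2) L2_scale[OF assms(2), of 2]])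
    show "(\<lambda>n. step (lcnj (approx g n)) s) \<longlonglongrightarrow> cnj (g s)" for s
      unfolding lcnj by (intro tendsto_cnj ap)
    show "cmod (step (lcnj (approx g n)) s) \<le> cmod (2 * cnj (g s))" for n s
      using ap(3)[of n s] by (auto simp: lcnj norm_mult)
  qed (use ap in \<open>auto simp: lcnj\<close>)
  then have "(\<lambda>n. cinner x (sop (lcnj (approx g n)) y)) \<longlonglongrightarrow> cinner x (fc (\<lambda>s. cnj (g s)) y)"
    by (intro tendsto_intros)
  moreover have "(\<lambda>n. cinner (sop (approx g n) x) y) \<longlonglongrightarrow> cinner (fc g x) y"
    by (intro tendsto_intros sop_approx_tendsto assms)
  ultimately show ?thesis
    unfolding sop_adjoint[OF ap(1)] using LIMSEQ_unique by blast
qed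

text \<open>A projection acts on \<open>fc g x\<close> by restricting the symbol, and the isometry
  then evaluates the mass of \<open>B\<close>. Domain questions about \<open>fc g x\<close> thereby
  become questions about \<open>x\<close>, as composition requires.\<close>

lemma scalar_measure_fc:
  assumes "L2 x g"
  shows "\<mu> (fc g x) = density (\<mu> x) (\<lambda>s. ennreal ((cmod (g s))\<^sup>2))"
proof (rule measure_eqI)
  have [measurable]: "g \<in> borel_measurable borel"
    using assms by (auto simp: L2_def)
  fix B assume "B \<in> sets (\<mu> (fc g x))"
  then have [measurable]: "B \<in> sets borel" by simp
  have "emeasure (\<mu> (fc g x)) B = ennreal (LINT s|\<mu> x. (cmod (indicator B s * g s))\<^sup>2)"
    using assms by (simp add: emeasure_\<mu> E_fc norm_fc L2_indicator)
  also have "\<dots> = (\<integral>\<^sup>+ s. ennreal ((cmod (indicator B s * g s))\<^sup>2) \<partial>\<mu> x)"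
    using L2_indicator[OF assms, of B] by (subst nn_integral_eq_integral) (auto simp: L2_def)
  also have "\<dots> = (\<integral>\<^sup>+ s. ennreal ((cmod (g s))\<^sup>2) * indicator B s \<partial>\<mu> x)"
    by (intro nn_integral_cong) (auto simp: indicator_def)
  also have "\<dots> = emeasure (density (\<mu> x) (\<lambda>s. ennreal ((cmod (g s))\<^sup>2))) B"
    by (subst emeasure_density) auto
  finally show "emeasure (\<mu> (fc g x)) B = emeasure (density (\<mu> x) (\<lambda>s. ennreal ((cmod (g s))\<^sup>2))) B" .
qed simp

lemma L2_fc_iff:
  assumes "L2 x g" and [measurable]: "h \<in> borel_measurable borel"
  shows "L2 (fc g x) h \<longleftrightarrow> L2 x (\<lambda>s. h s * g s)"
proof -
  have [measurable]: "g \<in> borel_measurable borel"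
    using assms by (auto simp: L2_def)
  show ?thesis
    unfolding L2_def scalar_measure_fc[OF assms(1)]
    by (subst integrable_density) (auto simp: norm_mult power_mult_distrib mult.commute)
qed

lemma integral_fc:
  assumes "L2 x g" and [measurable]: "h \<in> borel_measurable borel"
  shows "(LINT s|\<mu> (fc g x). h s) = (LINT s|\<mu> x. (cmod (g s))\<^sup>2 * h s :: real)"
proof -
  have [measurable]: "g \<in> borel_measurable borel"
    using assms by (auto simp: L2_def)
  show ?thesis
    unfolding scalar_measure_fc[OF assms(1)]
    by (subst integral_density) auto
qed

text \<open>For a step function \<open>h\<close> this is linearity together with
  \<open>E_fc\<close>. In general the approximants of \<open>h\<close> converge at
  \<open>fc g x\<close> by construction, while their products with \<open>g\<close> converge to
  \<open>h * g\<close> in the mean square for \<open>x\<close>.\<close>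

lemma fc_mult:
  assumes g: "L2 x g" and h: "L2 (fc g x) h"
  shows "fc h (fc g x) = fc (\<lambda>s. h s * g s) x"
proof -
  have [measurable]: "g \<in> borel_measurable borel" "h \<in> borel_measurable borel"
    using assms by (auto simp: L2_def)
  note ap = approx[OF this(2)]
  have hg: "L2 x (\<lambda>s. h s * g s)"
    using L2_fc_iff assms by auto
  have L: "L2 x (\<lambda>s. step l s * g s)" if "blist l" for l
  proof -
    obtain K where K: "\<And>s. cmod (step l s) \<le> K" using step_bounded by metis
    show ?thesis
      by (rule L2_mono[OF g, of _ K]) (use that K in \<open>auto simp: norm_mult intro!: mult_right_mono\<close>)
  qed
  have sl: "sop l (fc g x) = fc (\<lambda>s. step l s * g s) x" if "blist l" for l
    using that
  proof (induction l)
    case Nil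
    then show ?case using fc_scale[OF g, of 0] by simp
  next
    case (Cons a l)
    obtain c B where a: "a = (c, B)" by fastforce
    with Cons have B: "B \<in> sets borel" and l: "blist l" by auto
    have "fc (\<lambda>s. c * (indicator B s * g s) + step l s * g s) x = c *\<^sub>C E B (fc g x) + sop l (fc g x)"
      using fc_add[OF L2_scale[OF L2_indicator[OF g B]] L[OF l]] fc_scale[OF L2_indicator[OF g B]]
        Cons.IH[OF l] E_fc[OF g B] by simp
    then show ?case by (simp add: a algebra_simps)
  qed
  have d: "L2 x (\<lambda>s. step (approx h n) s * g s - h s * g s)" for n
    using L2_add[OF L[OF ap(1)] L2_scale[OF hg, of "-1"]] by simp
  have "(\<lambda>n. LINT s|\<mu> x. (cmod (step (approx h n) s * g s - h s * g s))\<^sup>2) \<longlonglongrightarrow> (LINT s|\<mu> x. (cmod 0)\<^sup>2)"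
  proof (rule L2_dominated_convergence[OF L2_scale[OF hg, of 3]])
    show "(\<lambda>n. step (approx h n) s * g s - h s * g s) \<longlonglongrightarrow> 0" for s
      by (intro LIM_zero tendsto_intros ap)
    show "cmod (step (approx h n) s * g s - h s * g s) \<le> cmod (3 * (h s * g s))" for n s
      using norm_triangle_ineq4[of "step (approx h n) s * g s" "h s * g s"]
        mult_right_mono[OF ap(3)[of n s], of "cmod (g s)"]
      by (simp add: norm_mult)
  qed (use ap in auto)
  then have "(\<lambda>n. (norm (sop (approx h n) (fc g x) - fc (\<lambda>s. h s * g s) x))\<^sup>2) \<longlonglongrightarrow> 0"
    using norm_fc[OF d] fc_diff[OF L[OF ap(1)] hg] sl[OF ap(1)] by simp
  then have "(\<lambda>n. sqrt ((norm (sop (approx h n) (fc g x) - fc (\<lambda>s. h s * g s) x))\<^sup>2)) \<longlonglongrightarrow> sqrt 0"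
    by (intro tendsto_intros)
  then have "(\<lambda>n. sop (approx h n) (fc g x)) \<longlonglongrightarrow> fc (\<lambda>s. h s * g s) x"
    by (simp add: tendsto_norm_zero_iff LIM_zero_iff)
  then show ?thesis
    using sop_approx_tendsto[OF h] LIMSEQ_unique by blast
qed

lemma fc_AE_zero:
  assumes "L2 x g" "AE s in \<mu> x. g s = 0"
  shows "fc g x = 0"
proof -
  have "(LINT s|\<mu> x. (cmod (g s))\<^sup>2) = (LINT s|\<mu> x. 0)"
    using assms by (intro integral_cong_AE) (auto simp: L2_def)
  then show ?thesis
    using norm_fc[OF assms(1)] by simp
qed

lemma fc_cong_AE:
  assumes "L2 x g" "L2 x h" "AE s in \<mu> x. g s = h s"
  shows "fc g x = fc h x"
  using fc_AE_zero[OF L2_add[OF assms(1) L2_scale[OF assms(2), of "-1"]]] fc_diff[OF assms(1,2)] assms(3)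
  by simp

section \<open>Linearity in the vector\<close>

text \<open>An inequality between masses of sets passes to nonnegative functions, which are built
  from indicators by multiples, sums and monotone limits. It shows that domains are linear subspaces
  although the scalar measure is quadratic in the vector.\<close>

lemma nn_integral_scalar_measure_dominated:
  assumes le: "\<And>B. B \<in> sets borel \<Longrightarrow> (norm (E B z))\<^sup>2 \<le> a * (norm (E B x))\<^sup>2 + b * (norm (E B y))\<^sup>2"
    and "g \<in> borel_measurable borel" "0 \<le> a" "0 \<le> b"
  shows "(\<integral>\<^sup>+ s. g s \<partial>\<mu> z) \<le> ennreal a * (\<integral>\<^sup>+ s. g s \<partial>\<mu> x) + ennreal b * (\<integral>\<^sup>+ s. g s \<partial>\<mu> y)"
  using \<open>g \<in> borel_measurable borel\<close>
proof (induction rule: borel_measurable_induct)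
  case (cong u v)
  then show ?case by (simp cong: nn_integral_cong)
next
  case (set B)
  then show ?case using ennreal_leI[OF le[of B]] assms by (simp add: emeasure_\<mu> ennreal_plus ennreal_mult)
next
  case (mult u c)
  from mult_left_mono[OF mult(4), of c] mult show ?case
    by (simp add: nn_integral_cmult algebra_simps)
next
  case (add u v)
  from add_mono[OF add.IH] add show ?case
    by (simp add: nn_integral_add algebra_simps)
next
  case (seq U)
  have "(\<integral>\<^sup>+ s. (SUP i. U i) s \<partial>\<mu> w) = (SUP i. \<integral>\<^sup>+ s. U i s \<partial>\<mu> w)" for w
    unfolding SUP_apply using seq by (subst nn_integral_monotone_convergence_SUP) auto
  moreover have "(\<integral>\<^sup>+ s. U i s \<partial>\<mu> z) \<le> ennreal a * (SUP i. \<integral>\<^sup>+ s. U i s \<partial>\<mu> x) + ennreal b * (SUP i. \<integral>\<^sup>+ s. U i s \<partial>\<mu> y)" for i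
    by (rule order_trans[OF seq.IH]) (auto intro!: add_mono mult_left_mono SUP_upper)
  ultimately show ?case
    by (simp add: SUP_le_iff)
qed

lemma L2_dominated:
  assumes le: "\<And>B. B \<in> sets borel \<Longrightarrow> (norm (E B z))\<^sup>2 \<le> a * (norm (E B x))\<^sup>2 + b * (norm (E B y))\<^sup>2"
    and "0 \<le> a" "0 \<le> b" "L2 x g" "L2 y g"
  shows "L2 z g"
proof -
  have [measurable]: "g \<in> borel_measurable borel"
    using assms by (auto simp: L2_def)
  have "(\<integral>\<^sup>+ s. ennreal ((cmod (g s))\<^sup>2) \<partial>\<mu> z) < \<infinity>"
    by (rule order.strict_trans1[OF nn_integral_scalar_measure_dominated[OF le]])
       (use assms in \<open>auto simp: L2_def integrable_iff_bounded ennreal_mult_less_top\<close>)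
  then show ?thesis
    by (auto simp: L2_def integrable_iff_bounded)
qed

lemma L2_add_vector: "L2 x g \<Longrightarrow> L2 y g \<Longrightarrow> L2 (x + y) g"
  by (rule L2_dominated[of _ 2 x 2 y]) (auto simp: E_add norm_add_sq_le)

lemma L2_scaleC_vector: "L2 x g \<Longrightarrow> L2 (a *\<^sub>C x) g"
  by (rule L2_dominated[of _ "(cmod a)\<^sup>2" x 0 x]) (auto simp: E_scaleC norm_scaleC power_mult_distrib)

lemma fc_add_vector:
  assumes "L2 x g" "L2 y g"
  shows "fc g (x + y) = fc g x + fc g y"
proof -
  have "blist (approx g n)" for n
    using assms approx by (auto simp: L2_def)
  then have "(\<lambda>n. sop (approx g n) x + sop (approx g n) y) \<longlonglongrightarrow> fc g (x + y)"
    using sop_approx_tendsto[OF L2_add_vector[OF assms]] by (simp add: sop_add)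
  moreover have "(\<lambda>n. sop (approx g n) x + sop (approx g n) y) \<longlonglongrightarrow> fc g x + fc g y"
    by (intro tendsto_intros sop_approx_tendsto assms)
  ultimately show ?thesis by (rule LIMSEQ_unique)
qed

lemma fc_scaleC_vector:
  assumes "L2 x g"
  shows "fc g (a *\<^sub>C x) = a *\<^sub>C fc g x"
proof -
  have "blist (approx g n)" for n
    using assms approx by (auto simp: L2_def)
  then have "(\<lambda>n. a *\<^sub>C sop (approx g n) x) \<longlonglongrightarrow> fc g (a *\<^sub>C x)"
    using sop_approx_tendsto[OF L2_scaleC_vector[OF assms]] by (simp add: sop_scaleC)
  moreover have "(\<lambda>n. a *\<^sub>C sop (approx g n) x) \<longlonglongrightarrow> a *\<^sub>C fc g x"
    by (intro tendsto_intros sop_approx_tendsto assms)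
  ultimately show ?thesis by (rule LIMSEQ_unique)
qed

section \<open>Dense domains and spectral integrals\<close>

text \<open>The sets where \<open>g\<close> is bounded by \<open>n\<close> exhaust the line. Their
  projections map into the domain of \<open>g\<close>, which is therefore dense.\<close>

lemma E_bounded_tendsto:
  assumes [measurable]: "g \<in> borel_measurable borel"
  shows "(\<lambda>n. E {s. cmod (g s) \<le> real n} x) \<longlonglongrightarrow> x"
proof -
  define B where "B n = {s. cmod (g s) \<le> real n}" for n
  have B: "B n \<in> sets borel" for n
    unfolding B_def by measurable
  have "(\<lambda>n. sop [(1, B n)] x) \<longlonglongrightarrow> fc (\<lambda>s. 1) x"
  proof (rule fc_limit[OF L2_const L2_const[of x 1]])
    show "(\<lambda>n. step [(1, B n)] s) \<longlonglongrightarrow> 1" for s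
    proof (rule tendsto_eventually)
      obtain N where "cmod (g s) \<le> real N"
        using real_arch_simple by blast
      then show "\<forall>\<^sub>F n in sequentially. step [(1, B n)] s = 1"
        by (intro eventually_sequentiallyI[of N]) (auto simp: B_def)
    qed
    show "cmod (step [(1, B n)] s) \<le> cmod 1" for n s
      by (auto simp: indicator_def)
  qed (use B in auto)
  then show ?thesis
    by (simp add: fc_one B_def)
qed

lemma L2_E_bounded:
  assumes [measurable]: "g \<in> borel_measurable borel"
    and "B \<in> sets borel" "\<And>s. s \<in> B \<Longrightarrow> cmod (g s) \<le> K" "0 \<le> K"
  shows "L2 (E B x) g"
proof -
  have i: "L2 x (indicator B)"
    by (rule L2_bounded[of _ 1]) (use assms in \<open>auto simp: indicator_def\<close>)
  have "L2 x (\<lambda>s. g s * indicator B s)"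
    by (rule L2_bounded[of _ K]) (use assms in \<open>auto simp: indicator_def\<close>)
  then show ?thesis
    using L2_fc_iff[OF i assms(1)] fc_indicator[OF assms(2)] by simp
qed

text \<open>The difference \<open>h - h'\<close> is tested against its own truncations, which lie in
  the domain; each of them vanishes, and they converge to \<open>h - h'\<close>.\<close>

lemma eq_if_cinner_eq_on_L2:
  assumes g: "g \<in> borel_measurable borel"
    and eq: "\<And>y. L2 y g \<Longrightarrow> cinner h y = cinner h' y"
  shows "h = h'"
proof -
  have [measurable]: "g \<in> borel_measurable borel" by fact
  let ?B = "\<lambda>n. {s. cmod (g s) \<le> real n}"
  have B: "?B n \<in> sets borel" for n by measurable
  have "E (?B n) (h - h') = 0" for n
  proof -
    have "cinner (h - h') (E (?B n) (h - h')) = 0"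
      using eq[OF L2_E_bounded[OF g B, of n "real n"]] by (simp add: cinner_diff_left)
    then have "cinner (E (?B n) (h - h')) (h - h') = 0"
      by (metis B E_cinner)
    then show ?thesis
      using E_cinner_self[OF B, of n "h - h'"] by simp
  qed
  then show ?thesis
    using E_bounded_tendsto[OF g, of "h - h'"] by (simp add: LIMSEQ_const_iff)
qed

text \<open>The integral of \<open>g\<close> against the measure of \<open>w\<close> is the
  quadratic form \<open>cinner (fc G w) w\<close>, so the polarization sum recovers
  \<open>cinner (fc G x) y\<close>. Density of the domain makes \<open>fc G x\<close> the only
  vector with these values.\<close>

lemma spectral_integral_eq:
  fixes g :: "real \<Rightarrow> real" and S :: "real set"
  defines "G \<equiv> \<lambda>s. complex_of_real (indicator S s * g s)"
  assumes G: "G \<in> borel_measurable borel"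
  shows "op_dom (spectral_integral E S g) = {x. L2 x G}"
    and "L2 x G \<Longrightarrow> op_app (spectral_integral E S g) x = fc G x"
proof -
  have D: "{x. set_integrable (\<mu> x) S (\<lambda>s. (g s)\<^sup>2)} = {x. L2 x G}"
  proof -
    have "(\<lambda>s. indicator S s *\<^sub>R (g s)\<^sup>2) = (\<lambda>s. (cmod (G s))\<^sup>2)"
      by (rule ext) (simp add: G_def indicator_def)
    then show ?thesis
      using G by (simp add: L2_def set_integrable_def)
  qed
  then show "op_dom (spectral_integral E S g) = {x. L2 x G}"
    by (simp add: spectral_integral_def op_dom_def Let_def)
  assume x: "L2 x G"
  define P where "P y = (\<Sum>k<4. \<i> ^ k * complex_of_real (set_lebesgue_integral (\<mu> (x + \<i> ^ k *\<^sub>C y)) S g)) / 4" for y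
  have P: "P y = cinner (fc G x) y" if y: "L2 y G" for y
  proof -
    have q: "complex_of_real (set_lebesgue_integral (\<mu> w) S g) = cinner (fc G w) w" if "L2 w G" for w
      using fc_cinner_self[OF that] unfolding G_def integral_complex_of_real set_lebesgue_integral_def
      by simp
    have w: "L2 (x + \<i> ^ k *\<^sub>C y) G" for k
      by (intro L2_add_vector L2_scaleC_vector x y)
    have e: "cinner (fc G (x + a *\<^sub>C y)) (x + a *\<^sub>C y) = cinner (fc G x) x + cnj a * cinner (fc G x) y
        + a * cinner (fc G y) x + a * cnj a * cinner (fc G y) y" for a
      using x y by (simp add: fc_add_vector fc_scaleC_vector L2_scaleC_vector cinner_add_left cinner_add_right
          cinner_scaleC_left cinner_scaleC_right algebra_simps)
    show ?thesis
      unfolding P_def q[OF w] e by (simp add: eval_nat_numeral algebra_simps)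
  qed
  have "op_app (spectral_integral E S g) x = (THE h. \<forall>y\<in>{y. L2 y G}. cinner h y = P y)"
    by (simp add: spectral_integral_def op_app_def Let_def D P_def)
  also have "\<dots> = fc G x"
  proof (rule the_equality)
    fix h assume "\<forall>y\<in>{y. L2 y G}. cinner h y = P y"
    then show "h = fc G x"
      using eq_if_cinner_eq_on_L2[OF G, of h "fc G x"] P by simp
  qed (use P in auto)
  finally show "op_app (spectral_integral E S g) x = fc G x" .
qed

lemma L2_cong_AE:
  assumes "L2 x g" "h \<in> borel_measurable borel" "AE s in \<mu> x. g s = h s"
  shows "L2 x h"
proof -
  have "integrable (\<mu> x) (\<lambda>s. (cmod (h s))\<^sup>2)"
    using assms by (subst integrable_cong_AE[where g = "\<lambda>s. (cmod (g s))\<^sup>2"]) (auto simp: L2_def)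
  then show ?thesis
    using assms by (simp add: L2_def)
qed

text \<open>By the isometry an operator bound is a pointwise estimate of symbols; the norm estimates
  below are obtained in this way.\<close>

lemma norm_fc_le:
  assumes "L2 x g" "L2 x h" "AE s in \<mu> x. cmod (g s) \<le> K * cmod (h s)" "0 \<le> K"
  shows "norm (fc g x) \<le> K * norm (fc h x)"
proof -
  have "(norm (fc g x))\<^sup>2 \<le> (LINT s|\<mu> x. K\<^sup>2 * (cmod (h s))\<^sup>2)"
    unfolding norm_fc[OF assms(1)]
  proof (rule integral_mono_AE)
    show "AE s in \<mu> x. (cmod (g s))\<^sup>2 \<le> K\<^sup>2 * (cmod (h s))\<^sup>2"
      using assms(3)
    proof eventually_elim
      case (elim s)
      then show ?case using power_mono[OF elim, of 2] by (simp add: power_mult_distrib)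
    qed
  qed (use assms in \<open>auto simp: L2_def\<close>)
  also have "\<dots> = (K * norm (fc h x))\<^sup>2"
    using norm_fc[OF assms(2)] by (simp add: power_mult_distrib)
  finally show ?thesis
    by (rule power2_le_imp_le) (simp add: assms(4))
qed

lemma fc_const: "fc (\<lambda>s. c) x = c *\<^sub>C x"
  using fc_scale[OF L2_const[of x 1], of c] by (simp add: fc_one)

lemma AE_not_in_if_E_zero: "B \<in> sets borel \<Longrightarrow> E B x = 0 \<Longrightarrow> AE s in \<mu> x. s \<notin> B"
  by (intro AE_not_in null_setsI) (auto simp: emeasure_\<mu>)

lemma E_eq_zero_mono:
  assumes "E B x = 0" "C \<subseteq> B" "B \<in> sets borel" "C \<in> sets borel"
  shows "E C x = 0"
proof -
  have "E C (E B x) = E C x"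
    using E_E[OF assms(4,3), of x] assms(2) by (simp add: Int_absorb2)
  then show ?thesis
    using assms E_zero by simp
qed

text \<open>Boundedness is asked everywhere, independently of any vector: such symbols lie in
  \<open>L2 x\<close> for all \<open>x\<close>, and the domain conditions of the calculus
  disappear.\<close>

definition bdd_borel :: "(real \<Rightarrow> complex) \<Rightarrow> bool" where
  "bdd_borel g \<longleftrightarrow> g \<in> borel_measurable borel \<and> (\<exists>K. \<forall>s. cmod (g s) \<le> K)"

lemma bdd_borelI: "g \<in> borel_measurable borel \<Longrightarrow> (\<And>s. cmod (g s) \<le> K) \<Longrightarrow> bdd_borel g"
  by (auto simp: bdd_borel_def)

lemma bdd_borel_const [simp]: "bdd_borel (\<lambda>s. c)"
  by (auto simp: bdd_borel_def)

lemma bdd_borel_indicator: "B \<in> sets borel \<Longrightarrow> bdd_borel (indicator B)"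
  by (auto simp: bdd_borel_def indicator_def intro!: exI[of _ 1])

lemma bdd_borel_mult [simp]: "bdd_borel g \<Longrightarrow> bdd_borel h \<Longrightarrow> bdd_borel (\<lambda>s. g s * h s)"
  unfolding bdd_borel_def norm_mult
proof (elim conjE exE, intro conjI exI allI)
  fix K L s assume "\<forall>s. cmod (g s) \<le> K" "\<forall>s. cmod (h s) \<le> L"
  then show "cmod (g s) * cmod (h s) \<le> K * L"
    using norm_ge_zero order_trans by (metis mult_mono)
qed auto

lemma bdd_borel_add [simp]: "bdd_borel g \<Longrightarrow> bdd_borel h \<Longrightarrow> bdd_borel (\<lambda>s. g s + h s)"
  unfolding bdd_borel_def
proof (elim conjE exE, intro conjI exI allI)
  fix K L s assume "\<forall>s. cmod (g s) \<le> K" "\<forall>s. cmod (h s) \<le> L"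
  then show "cmod (g s + h s) \<le> K + L"
    by (simp add: norm_triangle_mono)
qed auto

lemma L2_bdd_borel [simp]: "bdd_borel g \<Longrightarrow> L2 x g"
  by (auto simp: bdd_borel_def intro: L2_bounded)

lemma L2_bdd_borel_mult: "bdd_borel g \<Longrightarrow> L2 x h \<Longrightarrow> L2 x (\<lambda>s. g s * h s)"
proof -
  assume g: "bdd_borel g" and h: "L2 x h"
  then obtain K where "\<And>s. cmod (g s) \<le> K"
    by (auto simp: bdd_borel_def)
  with g h show ?thesis
    by (intro L2_mono[OF h, of _ K]) (auto simp: bdd_borel_def norm_mult mult_right_mono)
qed

text \<open>Symbols commute, so a bounded function of the operator preserves the domain of every
  other one.\<close>

lemma L2_fc: "bdd_borel g \<Longrightarrow> L2 x h \<Longrightarrow> L2 (fc g x) h"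
  using L2_bdd_borel_mult[of g x h] by (subst L2_fc_iff) (auto simp: mult.commute)

lemma fc_bdd_mult: "bdd_borel g \<Longrightarrow> bdd_borel h \<Longrightarrow> fc g (fc h x) = fc (\<lambda>s. g s * h s) x"
  by (simp add: fc_mult)

lemma fc_diff_vector: "bdd_borel g \<Longrightarrow> fc g (x - y) = fc g x - fc g y"
  using fc_add_vector[of "x - y" g y] by (simp add: algebra_simps)

lemma norm_fc_bdd_le:
  assumes "bdd_borel g"
  obtains K where "0 \<le> K" "\<And>x h. L2 x h \<Longrightarrow> norm (fc (\<lambda>s. g s * h s) x) \<le> K * norm (fc h x)"
proof -
  from assms obtain K where K: "\<And>s. cmod (g s) \<le> K"
    by (auto simp: bdd_borel_def)
  then have "0 \<le> K"
    using norm_ge_zero order_trans by blast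
  moreover have "norm (fc (\<lambda>s. g s * h s) x) \<le> K * norm (fc h x)" if "L2 x h" for x h
    using K \<open>0 \<le> K\<close> assms that
    by (intro norm_fc_le L2_bdd_borel_mult) (auto simp: norm_mult intro!: AE_I2 mult_right_mono)
  ultimately show ?thesis
    using that by blast
qed

end

section \<open>The spectrum as the support of the spectral measure\<close>

locale spectral_opr = pvm E for E :: "real set \<Rightarrow> 'a::complex_hilbert_space \<Rightarrow> 'a" +
  fixes A :: "'a opr"
  assumes A_eq: "op_eq A (spectral_integral E UNIV (\<lambda>s. s))"
begin

lemma dom_A: "op_dom A = {x. L2 x complex_of_real}"
  using A_eq spectral_integral_eq(1)[of UNIV "\<lambda>s. s"] by (simp add: op_eq_def)

lemma app_A: "L2 x complex_of_real \<Longrightarrow> op_app A x = fc complex_of_real x"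
  using A_eq spectral_integral_eq[of UNIV "\<lambda>s. s"] by (simp add: op_eq_def)

abbreviation S :: "real set" where "S \<equiv> real_spectrum A"

lemma shift_A:
  assumes "L2 x complex_of_real"
  shows "complex_of_real s *\<^sub>C x - op_app A x = fc (\<lambda>t. complex_of_real s - complex_of_real t) x"
  using fc_diff[OF L2_const[of x "complex_of_real s"] assms] fc_const assms by (simp add: app_A)

lemma L2_window: "L2 (E {s - d<..<s + d} x) complex_of_real"
  by (rule L2_E_bounded[where K = "\<bar>s\<bar> + \<bar>d\<bar>"]) auto

text \<open>If the window around \<open>s\<close> carried no projection, the function
  \<open>1 / (s - t)\<close>, put to \<open>0\<close> inside the window, would be bounded by
  \<open>1 / d\<close> and would invert \<open>s - t\<close> almost everywhere. Its operator would
  be a bounded inverse, against \<open>s \<in> S\<close>.\<close>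

lemma real_spectrum_imp_E_nonzero:
  assumes s: "s \<in> S" and d: "d > 0"
  shows "\<exists>x. E {s - d<..<s + d} x \<noteq> 0"
proof (rule ccontr)
  define I where "I = {s - d<..<s + d}"
  have I [measurable]: "I \<in> sets borel" by (simp add: I_def)
  assume "\<not> ?thesis"
  then have AE: "AE t in \<mu> x. t \<notin> I" for x
    using AE_not_in_if_E_zero[OF I] by (simp add: I_def)
  define R where "R t = (if t \<in> I then 0 else 1 / (complex_of_real s - complex_of_real t))" for t
  have R_meas [measurable]: "R \<in> borel_measurable borel"
    unfolding R_def by measurable
  have far: "d \<le> cmod (complex_of_real s - complex_of_real t)" if "t \<notin> I" for t
    using that unfolding of_real_diff[symmetric] norm_of_real by (auto simp: I_def)
  have R_le: "cmod (R t) \<le> 1 / d" for t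
    using far[of t] d by (auto simp: R_def norm_divide intro!: divide_left_mono mult_pos_pos)
  have R: "bdd_borel R"
    by (rule bdd_borelI[OF R_meas R_le])
  have Rs: "(complex_of_real s - complex_of_real t) * R t = (if t \<in> I then 0 else 1)" for t
    using far[of t] d by (cases "t \<in> I") (auto simp: R_def)
  have Rdiff: "bdd_borel (\<lambda>t. (complex_of_real s - complex_of_real t) * R t)"
    by (rule bdd_borelI[where K = 1]) (auto simp: Rs intro: borel_measurable_if)
  \<comment> \<open>\<open>t * R t\<close> equals \<open>s * R t\<close> minus
    \<open>(s - t) * R t\<close>, and both are bounded; hence \<open>fc R\<close> maps into the
    domain of \<open>A\<close>.\<close>
  have "bdd_borel (\<lambda>t. complex_of_real s * R t + (- 1) * ((complex_of_real s - complex_of_real t) * R t))"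
    by (intro bdd_borel_add bdd_borel_mult[OF bdd_borel_const] R Rdiff)
  then have Rt: "bdd_borel (\<lambda>t. complex_of_real t * R t)"
    by (simp add: algebra_simps)
  have RD: "L2 (fc R y) complex_of_real" for y
    using Rt R by (subst L2_fc_iff) auto
  have one: "fc (\<lambda>t. (complex_of_real s - complex_of_real t) * R t) y = y" for y
    using fc_cong_AE[OF L2_bdd_borel[OF Rdiff] L2_const[of y 1]] AE[of y] by (auto simp: Rs fc_one)
  have L2s: "L2 y (\<lambda>t. complex_of_real s - complex_of_real t)" if "L2 y complex_of_real" for y
    using L2_add[OF L2_const[of y "complex_of_real s"] L2_scale[OF that, of "-1"]] by simp
  have right: "complex_of_real s *\<^sub>C fc R y - op_app A (fc R y) = y" for y
    using fc_mult[OF L2_bdd_borel[OF R] L2s[OF RD]] by (simp add: shift_A[OF RD] one)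
  have left: "fc R (complex_of_real s *\<^sub>C y - op_app A y) = y" if "L2 y complex_of_real" for y
    using fc_mult[OF L2s[OF that] L2_bdd_borel[OF R]] by (simp add: shift_A[OF that] one mult.commute[of "R _"])
  have "bij_betw (\<lambda>x. complex_of_real s *\<^sub>C x - op_app A x) (op_dom A) UNIV"
    by (rule bij_betwI[where g = "fc R"]) (auto simp: dom_A RD left right)
  moreover have "norm x \<le> 1 / d * norm (complex_of_real s *\<^sub>C x - op_app A x)" if "x \<in> op_dom A" for x
  proof -
    have "norm (fc R y) \<le> 1 / d * norm (fc (\<lambda>t. 1) y)" for y
      using R_le d R by (intro norm_fc_le) auto
    then show ?thesis
      using that left by (metis dom_A fc_one mem_Collect_eq)
  qed
  ultimately have "complex_of_real s \<in> resolvent_set UNIV norm A"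
    unfolding resolvent_set_def by blast
  then show False
    using s by (simp add: real_spectrum_def spectrum_def)
qed

text \<open>On the range of the projection of a window of radius \<open>d\<close> the operator
  \<open>s - A\<close> has norm at most \<open>d\<close>, which is incompatible with an inverse
  bounded by \<open>C\<close> once \<open>\<bar>C\<bar> * d < 1\<close>.\<close>

lemma real_spectrumI:
  assumes E: "\<And>d. d > 0 \<Longrightarrow> \<exists>x. E {s - d<..<s + d} x \<noteq> 0"
  shows "s \<in> S"
proof (rule ccontr)
  assume "s \<notin> S"
  then obtain C where C: "\<And>x. x \<in> op_dom A \<Longrightarrow> norm x \<le> C * norm (complex_of_real s *\<^sub>C x - op_app A x)"
    by (auto simp: real_spectrum_def spectrum_def resolvent_set_def)
  \<comment> \<open>The sign of \<open>C\<close> is unknown, hence the absolute value.\<close>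
  define d where "d = 1 / (\<bar>C\<bar> + 1)"
  have d: "d > 0" "\<bar>C\<bar> * d < 1"
    by (auto simp: d_def field_simps add_pos_nonneg)
  define I where "I = {s - d<..<s + d}"
  have I [measurable]: "I \<in> sets borel" by (simp add: I_def)
  obtain x where x: "E I x \<noteq> 0"
    using E[OF d(1)] by (auto simp: I_def)
  have D: "L2 (E I x) complex_of_real"
    unfolding I_def by (rule L2_window)
  have i: "L2 x (indicator I)"
    by (intro L2_bdd_borel bdd_borel_indicator I)
  have L: "L2 (E I x) (\<lambda>t. complex_of_real s - complex_of_real t)"
    using L2_add[OF L2_const[of _ "complex_of_real s"] L2_scale[OF D, of "-1"]] by simp
  have "complex_of_real s *\<^sub>C E I x - op_app A (E I x) =
      fc (\<lambda>t. (complex_of_real s - complex_of_real t) * indicator I t) x"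
    using fc_mult[OF i] L D by (simp add: shift_A fc_indicator)
  moreover have "norm (fc (\<lambda>t. (complex_of_real s - complex_of_real t) * indicator I t) x) \<le> d * norm (fc (indicator I) x)"
  proof (rule norm_fc_le)
    show "L2 x (\<lambda>t. (complex_of_real s - complex_of_real t) * indicator I t)"
      using L L2_fc_iff[OF i, of "\<lambda>t. complex_of_real s - complex_of_real t"] by (simp add: fc_indicator)
    show "AE t in \<mu> x. cmod ((complex_of_real s - complex_of_real t) * indicator I t) \<le> d * cmod (indicator I t)"
      by (intro AE_I2) (auto simp: indicator_def I_def simp flip: of_real_diff)
  qed (use i d in auto)
  ultimately have "norm (complex_of_real s *\<^sub>C E I x - op_app A (E I x)) \<le> d * norm (E I x)"
    by (simp add: fc_indicator)
  then have "norm (E I x) \<le> \<bar>C\<bar> * (d * norm (E I x))"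
    using C[of "E I x"] D by (smt (verit, best) dom_A mem_Collect_eq mult_mono norm_ge_zero)
  then show False
    using x d by (smt (verit, best) mult.assoc mult_le_cancel_right1 norm_le_zero_iff)
qed

lemma closed_real_spectrum: "closed S"
  unfolding closed_def open_dist
proof (intro ballI)
  fix s assume "s \<in> - S"
  then obtain d where d: "d > 0" and z: "\<And>x. E {s - d<..<s + d} x = 0"
    using real_spectrumI by blast
  have "t \<in> - S" if "dist t s < d" for t
  proof -
    \<comment> \<open>This window around \<open>t\<close> lies inside the given window around
      \<open>s\<close>.\<close>
    have "E {t - (d - dist t s)<..<t + (d - dist t s)} x = 0" for x
      by (rule E_eq_zero_mono[OF z]) (auto simp: dist_real_def)
    then show ?thesis
      using real_spectrum_imp_E_nonzero[of t "d - dist t s"] that by auto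
  qed
  then show "\<exists>e>0. \<forall>t. dist t s < e \<longrightarrow> t \<in> - S"
    using d by blast
qed

lemma S_borel [measurable]: "S \<in> sets borel"
  using closed_real_spectrum by (rule borel_closed)

text \<open>Every point off the spectrum lies in an interval with rational endpoints whose
  projection annihilates \<open>x\<close>. There are only countably many such intervals, so together
  they are a null set.\<close>

lemma AE_in_S: "AE s in \<mu> x. s \<in> S"
proof -
  define X where "X = {(a, b). a \<in> \<rat> \<and> b \<in> \<rat> \<and> E {a<..<b} x = 0}"
  have "countable X"
    by (rule countable_subset[of _ "\<rat> \<times> \<rat>"]) (auto simp: X_def countable_rat)
  then have "AE s in \<mu> x. \<forall>p\<in>X. s \<notin> {fst p<..<snd p}"
    using AE_not_in_if_E_zero[of "{fst p<..<snd p}" x for p]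
    by (subst AE_ball_countable) (auto simp: X_def simp del: greaterThanLessThan_iff)
  then show ?thesis
  proof eventually_elim
    case (elim s)
    show "s \<in> S"
    proof (rule ccontr)
      assume "s \<notin> S"
      then obtain d where d: "d > 0" and z: "\<And>x. E {s - d<..<s + d} x = 0"
        using real_spectrumI by blast
      obtain a b where ab: "a \<in> \<rat>" "s - d < a" "a < s" "b \<in> \<rat>" "s < b" "b < s + d"
        using Rats_dense_in_real[of "s - d" s] Rats_dense_in_real[of s "s + d"] d by auto
      then have "E {a<..<b} x = 0"
        by (intro E_eq_zero_mono[OF z]) auto
      then show False
        using elim ab by (auto simp: X_def)
    qed
  qed
qed

text \<open>The constant is the lower bound of the quadratic form. A spectral point \<open>s\<close>
  below \<open>c\<close> would yield a nonzero vector in a window below \<open>c\<close>, where the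
  form is at most \<open>s + d < c\<close> times the squared norm.\<close>

lemma strictly_positive_spectrum:
  assumes "strictly_positive A"
  shows "\<exists>c>0. \<forall>s\<in>S. c \<le> s"
proof -
  obtain c where c: "c > 0" "\<And>x. x \<in> op_dom A \<Longrightarrow> c * (norm x)\<^sup>2 \<le> Re (cinner (op_app A x) x)"
    using assms unfolding strictly_positive_def by blast
  have "c \<le> s" if s: "s \<in> S" for s
  proof (rule ccontr)
    assume "\<not> c \<le> s"
    define d where "d = (c - s) / 2"
    have d: "d > 0" "s + d < c"
      using \<open>\<not> c \<le> s\<close> by (auto simp: d_def field_simps)
    define I where "I = {s - d<..<s + d}"
    have I [measurable]: "I \<in> sets borel" by (simp add: I_def)
    obtain x where x: "E I x \<noteq> 0"
      using real_spectrum_imp_E_nonzero[OF s d(1)] by (auto simp: I_def)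
    have D: "L2 (E I x) complex_of_real"
      unfolding I_def by (rule L2_window)
    have i: "L2 x (indicator I)"
      by (intro L2_bdd_borel bdd_borel_indicator I)
    have "cinner (op_app A (E I x)) (E I x) = complex_of_real (LINT t|\<mu> (E I x). t)"
      using fc_cinner_self[OF D] D by (simp add: app_A)
    also have "(LINT t|\<mu> (E I x). t) = (LINT t|\<mu> x. (cmod (indicator I t))\<^sup>2 * t)"
      using integral_fc[OF i, of "\<lambda>t. t"] by (simp add: fc_indicator)
    also have "\<dots> = (LINT t|\<mu> x. indicator I t * t)"
      by (intro Bochner_Integration.integral_cong) (auto simp: indicator_def)
    finally have "c * (norm (E I x))\<^sup>2 \<le> (LINT t|\<mu> x. indicator I t * t)"
      using c(2)[of "E I x"] D by (simp add: dom_A)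
    also have "\<dots> \<le> (LINT t|\<mu> x. indicator I t * (s + d))"
    proof (rule integral_mono)
      show "integrable (\<mu> x) (\<lambda>t. indicator I t * t)"
        by (rule integrable_bounded[where K = "\<bar>s\<bar> + d"]) (use d in \<open>auto simp: indicator_def I_def\<close>)
      show "integrable (\<mu> x) (\<lambda>t. indicator I t * (s + d))"
        by (rule integrable_bounded[where K = "\<bar>s + d\<bar>"]) (auto simp: indicator_def)
    qed (auto simp: indicator_def I_def)
    also have "\<dots> = (s + d) * (norm (E I x))\<^sup>2"
      by (simp add: measure_\<mu>)
    finally show False
      using x d by simp
  qed
  with c(1) show ?thesis by blast
qed

end

section \<open>The resolvent of the damped operator\<close>

locale damped = spectral_opr E A for E :: "real set \<Rightarrow> 'a::complex_hilbert_space \<Rightarrow> 'a" and A +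
  fixes f :: "real \<Rightarrow> real"
  assumes pos: "strictly_positive A"
    and cont: "continuous_on S f"
    and nonneg: "\<And>s. s \<in> S \<Longrightarrow> 0 \<le> f s"
begin

lemma S_pos: "s \<in> S \<Longrightarrow> 0 < s"
  using strictly_positive_spectrum[OF pos] by force

text \<open>
  The symbols of \<open>A\<close>, \<open>f(A)\<close> and \<open>A\<^sup>1\<^sup>/\<^sup>2\<close>, set to \<open>0\<close> off the spectrum, where \<open>f\<close> is arbitrary.
\<close>

definition a :: "real \<Rightarrow> complex" where "a s = complex_of_real (indicator S s * s)"
definition b :: "real \<Rightarrow> complex" where "b s = complex_of_real (indicator S s * f s)"
definition r :: "real \<Rightarrow> complex" where "r s = complex_of_real (indicator S s * sqrt s)"

lemma measurable_symbols [measurable]: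
  "a \<in> borel_measurable borel" "b \<in> borel_measurable borel" "r \<in> borel_measurable borel"
proof -
  have "(\<lambda>s. indicator S s *\<^sub>R f s) \<in> borel_measurable borel"
    by (rule borel_measurable_continuous_on_indicator) (auto simp: cont)
  then have [measurable]: "(\<lambda>s. indicator S s * f s) \<in> borel_measurable borel"
    by simp
  show "a \<in> borel_measurable borel" "b \<in> borel_measurable borel" "r \<in> borel_measurable borel"
    unfolding a_def[abs_def] b_def[abs_def] r_def[abs_def] by measurable
qed

lemma symbols_in_S: "s \<in> S \<Longrightarrow> a s = complex_of_real s" "s \<in> S \<Longrightarrow> b s = complex_of_real (f s)"
  "s \<in> S \<Longrightarrow> r s = complex_of_real (sqrt s)"
  and symbols_notin_S: "s \<notin> S \<Longrightarrow> a s = 0" "s \<notin> S \<Longrightarrow> b s = 0" "s \<notin> S \<Longrightarrow> r s = 0"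
  by (auto simp: a_def b_def r_def)

lemma cnj_symbols [simp]: "cnj (a s) = a s" "cnj (b s) = b s"
  by (auto simp: a_def b_def)

lemma r_r: "r s * r s = a s"
  using S_pos[of s] by (auto simp: a_def r_def indicator_def simp flip: of_real_mult)

text \<open>\<open>A\<close> is an integral over the whole line, \<open>f(A)\<close> one over
  \<open>S\<close> only. As the measures are carried by \<open>S\<close>, symbols cut off to
  \<open>S\<close> describe both.\<close>

lemma AE_a: "AE s in \<mu> x. a s = complex_of_real s"
  using AE_in_S[of x] by eventually_elim (rule symbols_in_S)

lemma L2_a_iff: "L2 x a \<longleftrightarrow> L2 x complex_of_real"
  using L2_cong_AE[of x a complex_of_real] L2_cong_AE[of x complex_of_real a] AE_a[of x]
  by (auto simp: eq_commute[of "complex_of_real _" "a _"])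

lemma dom_A_a: "op_dom A = {x. L2 x a}"
  by (simp add: dom_A L2_a_iff)

lemma app_A_a: "L2 x a \<Longrightarrow> op_app A x = fc a x"
  using L2_a_iff[of x] fc_cong_AE[OF _ _ AE_a] by (simp add: app_A)

lemma dom_f: "op_dom (func_calc A E f) = {x. L2 x b}"
  unfolding func_calc_def using measurable_symbols(2) spectral_integral_eq(1)[of S f]
  by (simp add: b_def[abs_def])

lemma app_f: "L2 x b \<Longrightarrow> op_app (func_calc A E f) x = fc b x"
  unfolding func_calc_def using measurable_symbols(2) spectral_integral_eq(2)[of S f x]
  by (simp add: b_def[abs_def])

lemma r_powr: "r = (\<lambda>s. complex_of_real (indicator S s * s powr (1 / 2)))"
proof (rule ext)
  fix s show "r s = complex_of_real (indicator S s * s powr (1 / 2))"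
    using S_pos[of s] by (auto simp: r_def indicator_def powr_half_sqrt)
qed

lemma scale_space_eq: "scale_space A E 1 = {x. L2 x r}"
  unfolding scale_space_def opr_powr_def func_calc_def
  using measurable_symbols(3) spectral_integral_eq(1)[of S "\<lambda>s. s powr (1 / 2)"]
  by (simp add: r_powr)

lemma scale_norm_eq: "L2 x r \<Longrightarrow> scale_norm A E 1 x = norm (fc r x)"
  unfolding scale_norm_def opr_powr_def func_calc_def
  using measurable_symbols(3) spectral_integral_eq(2)[of S "\<lambda>s. s powr (1 / 2)" x]
  by (simp add: r_powr)

lemma phase_space_eq: "phase_space A E = {(u, v). L2 u r}"
  by (auto simp: phase_space_def scale_space_eq)

lemma phase_norm_eq: "L2 u r \<Longrightarrow> phase_norm A E (u, v) = sqrt ((norm (fc r u))\<^sup>2 + (norm v)\<^sup>2)"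
  by (simp add: phase_norm_def scale_norm_eq)

text \<open>
  The common domain of \<open>A\<close> and \<open>f(A)\<close> is the range of \<open>k(A)\<close>, which turns the duality
  condition \<open>weak_sum\<close> into an equation between bounded operators.
\<close>

definition k :: "real \<Rightarrow> complex" where "k s = 1 / (1 + a s + b s)"

lemma one_plus_eq: "1 + a s + b s = complex_of_real (1 + indicator S s * s + indicator S s * f s)"
  by (simp add: a_def b_def)

lemma one_plus_ge: "1 \<le> 1 + indicator S s * s + indicator S s * f s"
  using S_pos[of s] nonneg[of s] by (auto simp: indicator_def)

lemma k_mult: "k s * (1 + a s + b s) = 1" "(1 + a s + b s) * k s = 1"
proof -
  have "1 + a s + b s \<noteq> 0"
    unfolding one_plus_eq of_real_eq_0_iff using one_plus_ge[of s] by linarith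
  then show "k s * (1 + a s + b s) = 1" "(1 + a s + b s) * k s = 1"
    by (auto simp: k_def)
qed

lemma cnj_k [simp]: "cnj (k s) = k s"
  by (simp add: k_def)

text \<open>The three numerators \<open>1\<close>, \<open>a\<close> and \<open>b\<close> are
  nonnegative summands of the denominator of \<open>k\<close>.\<close>

lemma bdd_k: "bdd_borel k" "bdd_borel (\<lambda>s. a s * k s)" "bdd_borel (\<lambda>s. b s * k s)"
proof -
  have [measurable]: "k \<in> borel_measurable borel"
    unfolding k_def[abs_def] by measurable
  have n: "cmod (t * k s) \<le> 1" if "cmod t \<le> 1 + indicator S s * s + indicator S s * f s" for s t
    unfolding k_def one_plus_eq norm_mult norm_divide norm_of_real
    using that one_plus_ge[of s] by simp
  have 1: "cmod (k s) \<le> 1" for s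
    using n[of 1 s] one_plus_ge[of s] by simp
  have 2: "cmod (a s * k s) \<le> 1" "cmod (b s * k s) \<le> 1" for s
    by (rule n; cases "s \<in> S"; use S_pos[of s] nonneg[of s] in \<open>simp add: a_def b_def\<close>)+
  show "bdd_borel k" "bdd_borel (\<lambda>s. a s * k s)" "bdd_borel (\<lambda>s. b s * k s)"
    by (rule bdd_borelI[where K = 1]; use 1 2 in simp)+
qed

text \<open>Each test vector is \<open>w = fc k y\<close> with
  \<open>y = fc (\<lambda>s. 1 + a s + b s) w\<close>. Moving the bounded operators to the other
  side of the inner product leaves a test against all \<open>y\<close>, hence an equation of
  vectors.\<close>

lemma weak_sum_iff:
  "weak_sum A (func_calc A E f) u v h \<longleftrightarrow> fc (\<lambda>s. a s * k s) u + fc (\<lambda>s. b s * k s) v = fc k h"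
proof -
  have key: "cinner (op_app A (fc k y)) u + cinner (op_app (func_calc A E f) (fc k y)) v =
      cinner y (fc (\<lambda>s. a s * k s) u + fc (\<lambda>s. b s * k s) v)"
    "cinner (fc k y) h = cinner y (fc k h)"
    "fc k y \<in> op_dom A \<inter> op_dom (func_calc A E f)" for y
  proof -
    have D: "L2 (fc k y) a" "L2 (fc k y) b"
      using bdd_k by (auto simp: L2_fc_iff)
    then show "fc k y \<in> op_dom A \<inter> op_dom (func_calc A E f)"
      by (simp add: dom_A_a dom_f)
    show "cinner (fc k y) h = cinner y (fc k h)"
      using fc_adjoint[of y k h] bdd_k by simp
    show "cinner (op_app A (fc k y)) u + cinner (op_app (func_calc A E f) (fc k y)) v =
      cinner y (fc (\<lambda>s. a s * k s) u + fc (\<lambda>s. b s * k s) v)"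
      using D bdd_k fc_adjoint[of y "\<lambda>s. a s * k s" u] fc_adjoint[of y "\<lambda>s. b s * k s" v]
      by (simp add: app_A_a app_f fc_mult cinner_add_right)
  qed
  have ran: "\<exists>y. w = fc k y" if "w \<in> op_dom A \<inter> op_dom (func_calc A E f)" for w
  proof -
    have L: "L2 w (\<lambda>s. 1 + a s + b s)"
      using that by (intro L2_add L2_const) (auto simp: dom_A_a dom_f)
    then have "fc k (fc (\<lambda>s. 1 + a s + b s) w) = w"
      using bdd_k by (simp add: fc_mult k_mult fc_one)
    then show ?thesis by metis
  qed
  have "weak_sum A (func_calc A E f) u v h \<longleftrightarrow>
      (\<forall>y. cinner y (fc (\<lambda>s. a s * k s) u + fc (\<lambda>s. b s * k s) v) = cinner y (fc k h))"
    (is "?w \<longleftrightarrow> ?e")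
  proof
    assume ?w
    then show ?e
      using key by (auto simp: weak_sum_def)
  next
    assume ?e
    show ?w
      unfolding weak_sum_def
    proof
      fix w assume "w \<in> op_dom A \<inter> op_dom (func_calc A E f)"
      then obtain y where "w = fc k y"
        using ran by blast
      then show "cinner (op_app A w) u + cinner (op_app (func_calc A E f) w) v = cinner w h"
        using key(1,2)[of y] \<open>?e\<close> by simp
    qed
  qed
  also have "\<dots> \<longleftrightarrow> fc (\<lambda>s. a s * k s) u + fc (\<lambda>s. b s * k s) v = fc k h" (is "_ \<longleftrightarrow> ?l = ?r")
  proof
    assume "\<forall>y. cinner y ?l = cinner y ?r"
    then have "cinner (?l - ?r) (?l - ?r) = 0"
      by (simp only: cinner_diff_right) simp
    then show "?l = ?r"
      by (simp add: cinner_self)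
  qed simp
  finally show ?thesis .
qed

text \<open>\<open>1 + a + b\<close> provides a left inverse of \<open>fc k\<close>. With
  \<open>weak_sum_iff\<close> it makes the vector \<open>h\<close> unique, so the description in
  \<open>damped_opr\<close> is definite.\<close>

lemma fc_k_inj: "fc k h = fc k h' \<Longrightarrow> h = h'"
proof -
  assume "fc k h = fc k h'"
  moreover have "fc (\<lambda>s. 1 + a s + b s) (fc k y) = y" for y
  proof -
    have "L2 (fc k y) (\<lambda>s. 1 + a s + b s)"
      by (subst L2_fc_iff) (auto simp: bdd_k k_mult L2_const)
    then show ?thesis
      by (simp add: fc_mult bdd_k k_mult fc_one)
  qed
  ultimately show ?thesis by metis
qed

lemma op_app_damped:
  assumes "weak_sum A (func_calc A E f) u v h"
  shows "op_app (damped_opr A E f) (u, v) = (v, - h)"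
proof -
  have "(THE h. weak_sum A (func_calc A E f) u v h) = h"
    using assms by (intro the_equality) (auto simp: weak_sum_iff intro: fc_k_inj)
  then show ?thesis
    by (simp add: op_app_def damped_opr_def)
qed

lemma op_dom_damped:
  "op_dom (damped_opr A E f) = {(u, v). L2 u r \<and> L2 v r \<and> (\<exists>h. weak_sum A (func_calc A E f) u v h)}"
  by (auto simp: op_dom_def damped_opr_def phase_space_eq scale_space_eq)

definition m :: "complex \<Rightarrow> real \<Rightarrow> complex" where "m z s = z\<^sup>2 + z * b s + a s"

text \<open>
  Solving \<open>z u - v = p\<close>, \<open>z v + A u + f(A) v = q\<close> gives \<open>u = ((z + f) / m) p + (1 / m) q\<close> and
  \<open>v = (z / m) q - (s / m) p\<close>.
\<close>

lemma resolvent_if_bounded_below: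
  assumes c: "c > 0" and below: "\<And>s. s \<in> S \<Longrightarrow> c * (1 + s + f s) \<le> cmod (m z s)"
  shows "z \<in> resolvent_set (phase_space A E) (phase_norm A E) (damped_opr A E f)"
proof -
  \<comment> \<open>\<open>i\<close> is the symbol \<open>1 / m\<close>, put to \<open>0\<close> off
    \<open>S\<close>, where the lower bound says nothing.\<close>
  define i where "i s = indicator S s / m z s" for s
  have i_meas [measurable]: "i \<in> borel_measurable borel"
    unfolding i_def m_def by measurable
  \<comment> \<open>Each of \<open>1\<close>, \<open>s\<close> and \<open>f s\<close> is at most
    \<open>1 + s + f s\<close>, the weight in the lower bound.\<close>
  have le: "1 * cmod (i s) \<le> 1 / c \<and> s * cmod (i s) \<le> 1 / c \<and> f s * cmod (i s) \<le> 1 / c" if "s \<in> S" for s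
  proof -
    have "0 < c * (1 + s + f s)"
      using c S_pos[OF that] nonneg[OF that] by simp
    then have i_le: "cmod (i s) \<le> 1 / (c * (1 + s + f s))"
      using below[OF that] that by (auto simp: i_def norm_divide intro!: divide_left_mono mult_pos_pos)
    have "t * cmod (i s) \<le> 1 / c" if "0 \<le> t" "t \<le> 1 + s + f s" for t
    proof -
      have "t * cmod (i s) \<le> (1 + s + f s) * (1 / (c * (1 + s + f s)))"
        using i_le that by (intro mult_mono) auto
      also have "\<dots> = 1 / c"
        using \<open>0 < c * (1 + s + f s)\<close> by auto
      finally show ?thesis .
    qed
    from this[of 1] this[of s] this[of "f s"] show ?thesis
      using S_pos[OF that] nonneg[OF that] by simp
  qed
  have i: "bdd_borel i"
  proof (rule bdd_borelI[where K = "1 / c"])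
    show "cmod (i s) \<le> 1 / c" for s
      using le[of s] c by (cases "s \<in> S") (auto simp: i_def)
  qed measurable
  have ai: "bdd_borel (\<lambda>s. a s * i s)"
  proof (rule bdd_borelI[where K = "1 / c"])
    show "cmod (a s * i s) \<le> 1 / c" for s
      using le[of s] c S_pos[of s] by (cases "s \<in> S") (auto simp: norm_mult symbols_in_S symbols_notin_S)
  qed measurable
  have bi: "bdd_borel (\<lambda>s. b s * i s)"
  proof (rule bdd_borelI[where K = "1 / c"])
    show "cmod (b s * i s) \<le> 1 / c" for s
      using le[of s] c nonneg[of s] by (cases "s \<in> S") (auto simp: norm_mult symbols_in_S symbols_notin_S)
  qed measurable
  \<comment> \<open>This factor carries \<open>q\<close>, which is merely in \<open>H\<close>, into
    \<open>H^1\<close>. The constant adds the bounds for \<open>1\<close> and \<open>s\<close>, by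
    \<open>sqrt s \<le> 1 + s\<close>.\<close>
  have ri: "bdd_borel (\<lambda>s. r s * i s)"
  proof (rule bdd_borelI[where K = "2 / c"])
    show "cmod (r s * i s) \<le> 2 / c" for s
    proof (cases "s \<in> S")
      case True
      have "sqrt s \<le> 1 + s"
        using S_pos[OF True] by (intro real_le_lsqrt) (auto simp: power2_eq_square algebra_simps)
      then have "sqrt s * cmod (i s) \<le> (1 + s) * cmod (i s)"
        by (intro mult_right_mono) auto
      also have "\<dots> \<le> 2 / c"
        using le[OF True] by (simp add: algebra_simps)
      finally show ?thesis
        using True S_pos[OF True] by (simp add: norm_mult symbols_in_S)
    qed (use c in \<open>auto simp: symbols_notin_S\<close>)
  qed measurable
  define g where "g s = (z + b s) * i s" for s
  have g: "bdd_borel g"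
    using bdd_borel_add[OF bdd_borel_mult[OF bdd_borel_const i] bi, of z]
    by (simp add: g_def[abs_def] distrib_right)
  have im: "i s * m z s = 1" if "s \<in> S" for s
  proof -
    have "0 < c * (1 + s + f s)"
      using c S_pos[OF that] nonneg[OF that] by simp
    then have "m z s \<noteq> 0"
      using below[OF that] by auto
    then show ?thesis
      using that by (simp add: i_def)
  qed
  have gz: "bdd_borel (\<lambda>s. z * g s)"
    using g by simp
  define U where "U p q = fc g p + fc i q" for p q
  define V where "V p q = z *\<^sub>C fc i q - fc (\<lambda>s. a s * i s) p" for p q
  have iq: "L2 (fc i q) r" for q
    using i ri by (simp add: L2_fc_iff)
  have U_r: "L2 (U p q) r" if "L2 p r" for p q
    unfolding U_def using g that by (intro L2_add_vector L2_fc iq)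
  have zU: "z *\<^sub>C U p q - V p q = p" for p q
  proof -
    have "z *\<^sub>C U p q - V p q = fc (\<lambda>s. z * g s + a s * i s) p"
      using g gz ai by (simp add: U_def V_def scaleC_add_right fc_scale fc_add)
    also have "\<dots> = fc (\<lambda>s. 1) p"
    proof (rule fc_cong_AE)
      show "AE s in \<mu> p. z * g s + a s * i s = 1"
        using AE_in_S[of p] by eventually_elim (use im in \<open>simp add: g_def m_def algebra_simps power2_eq_square\<close>)
    qed (use gz ai in auto)
    finally show ?thesis by (simp add: fc_one)
  qed
  have V_r: "L2 (V p q) r" if "L2 p r" for p q
  proof -
    have "L2 (z *\<^sub>C U p q + (- 1) *\<^sub>C p) r"
      by (intro L2_add_vector L2_scaleC_vector U_r that)
    moreover have "z *\<^sub>C U p q + (- 1) *\<^sub>C p = V p q"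
      using zU[of p q] by (simp add: scaleC_minus_left algebra_simps)
    ultimately show ?thesis by simp
  qed
  have weak: "weak_sum A (func_calc A E f) (U p q) (V p q) (q - z *\<^sub>C V p q)" for p q
  proof -
    define ak bk where "ak = (\<lambda>s. a s * k s)" and "bk = (\<lambda>s. b s * k s)"
    have [simp]: "bdd_borel ak" "bdd_borel bk" "bdd_borel k" "bdd_borel g" "bdd_borel i"
        "bdd_borel (\<lambda>s. a s * i s)" "bdd_borel (\<lambda>s. b s * i s)"
      using bdd_k g i ai bi by (auto simp: ak_def bk_def)
    \<comment> \<open>The identity for \<open>p\<close> holds for symbols everywhere, both sides
      being \<open>(z + b) * a * i * k\<close>. The one for \<open>q\<close> is
      \<open>i * m = 1\<close> multiplied by \<open>k\<close>; it is true on \<open>S\<close> only,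
      hence almost everywhere.\<close>
    have p: "fc (\<lambda>s. ak s * g s) p = fc (\<lambda>s. bk s * (a s * i s)) p + z *\<^sub>C fc (\<lambda>s. k s * (a s * i s)) p"
    proof -
      have "(\<lambda>s. ak s * g s) = (\<lambda>s. bk s * (a s * i s) + z * (k s * (a s * i s)))"
        by (simp add: g_def ak_def bk_def algebra_simps)
      then show ?thesis
        by (simp add: fc_add fc_scale)
    qed
    have q: "fc (\<lambda>s. ak s * i s) q + z *\<^sub>C fc (\<lambda>s. bk s * i s) q + z *\<^sub>C z *\<^sub>C fc (\<lambda>s. k s * i s) q = fc k q"
    proof -
      have "fc (\<lambda>s. ak s * i s) q + z *\<^sub>C fc (\<lambda>s. bk s * i s) q + z *\<^sub>C z *\<^sub>C fc (\<lambda>s. k s * i s) q =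
          fc (\<lambda>s. ak s * i s + z * (bk s * i s) + z * (z * (k s * i s))) q"
        by (simp add: fc_add fc_scale)
      also have "\<dots> = fc k q"
      proof (rule fc_cong_AE)
        show "AE s in \<mu> q. ak s * i s + z * (bk s * i s) + z * (z * (k s * i s)) = k s"
          using AE_in_S[of q]
        proof eventually_elim
          case (elim s)
          have "ak s * i s + z * (bk s * i s) + z * (z * (k s * i s)) = k s * (i s * m z s)"
            by (simp add: ak_def bk_def m_def algebra_simps power2_eq_square)
          then show ?case using im[OF elim] by simp
        qed
      qed auto
      finally show ?thesis .
    qed
    have "fc ak (U p q) + fc bk (V p q) = fc (\<lambda>s. ak s * g s) p + fc (\<lambda>s. ak s * i s) q
        + (z *\<^sub>C fc (\<lambda>s. bk s * i s) q - fc (\<lambda>s. bk s * (a s * i s)) p)"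
      by (simp add: U_def V_def fc_add_vector fc_diff_vector fc_scaleC_vector fc_bdd_mult)
    moreover have "fc k (q - z *\<^sub>C V p q) = fc k q
        - (z *\<^sub>C z *\<^sub>C fc (\<lambda>s. k s * i s) q - z *\<^sub>C fc (\<lambda>s. k s * (a s * i s)) p)"
      by (simp add: V_def fc_diff_vector fc_scaleC_vector fc_bdd_mult scaleC_diff_right)
    ultimately have "fc ak (U p q) + fc bk (V p q) = fc k (q - z *\<^sub>C V p q)"
      unfolding p q[symmetric] by simp
    then show ?thesis
      by (simp add: weak_sum_iff ak_def bk_def)
  qed
  have left: "U (z *\<^sub>C u - v) (z *\<^sub>C v + h) = u \<and> V (z *\<^sub>C u - v) (z *\<^sub>C v + h) = v"
    if w: "weak_sum A (func_calc A E f) u v h" for u v h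
  proof -
    define ak bk where "ak = (\<lambda>s. a s * k s)" and "bk = (\<lambda>s. b s * k s)"
    \<comment> \<open>As \<open>j * k = i\<close>, applying \<open>fc j\<close> to the equation of
      \<open>weak_sum_iff\<close> trades the factor \<open>k\<close> for \<open>i\<close>.\<close>
    define j where "j s = i s * (1 + a s + b s)" for s
    have j: "bdd_borel j"
      using bdd_borel_add[OF bdd_borel_add[OF i ai] bi] by (simp add: j_def[abs_def] algebra_simps)
    have jk: "(\<lambda>s. j s * k s) = i" "(\<lambda>s. j s * ak s) = (\<lambda>s. a s * i s)" "(\<lambda>s. j s * bk s) = (\<lambda>s. b s * i s)"
      by (auto simp: j_def ak_def bk_def k_mult mult.assoc mult.left_commute mult.commute)
    have "fc j (fc ak u + fc bk v) = fc j (fc k h)"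
      using w by (simp add: weak_sum_iff ak_def bk_def)
    then have h: "fc i h = fc (\<lambda>s. a s * i s) u + fc (\<lambda>s. b s * i s) v"
      using j bdd_k by (simp add: fc_add_vector fc_bdd_mult jk ak_def[symmetric] bk_def[symmetric])
    have gv: "fc g v = z *\<^sub>C fc i v + fc (\<lambda>s. b s * i s) v"
      using i bi by (simp add: g_def[abs_def] distrib_right fc_add fc_scale)
    have "U (z *\<^sub>C u - v) (z *\<^sub>C v + h) = z *\<^sub>C fc g u + fc (\<lambda>s. a s * i s) u"
      using g i by (simp add: U_def fc_diff_vector fc_add_vector fc_scaleC_vector h gv)
    also have "\<dots> = fc (\<lambda>s. z * g s + a s * i s) u"
      using g gz ai by (simp add: fc_add fc_scale)
    also have "\<dots> = fc (\<lambda>s. 1) u"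
    proof (rule fc_cong_AE)
      show "AE s in \<mu> u. z * g s + a s * i s = 1"
        using AE_in_S[of u] by eventually_elim (use im in \<open>simp add: g_def m_def algebra_simps power2_eq_square\<close>)
    qed (use gz ai in auto)
    finally have "U (z *\<^sub>C u - v) (z *\<^sub>C v + h) = u" by (simp add: fc_one)
    with zU[of "z *\<^sub>C u - v" "z *\<^sub>C v + h"] show ?thesis
      by simp
  qed
  have T: "z *\<^sub>C (u, v) - op_app (damped_opr A E f) (u, v) = (z *\<^sub>C u - v, z *\<^sub>C v + h)"
    if "weak_sum A (func_calc A E f) u v h" for u v h
    by (simp add: op_app_damped[OF that] scaleC_prod_def)
  have "bij_betw (\<lambda>x. z *\<^sub>C x - op_app (damped_opr A E f) x) (op_dom (damped_opr A E f)) (phase_space A E)"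
  proof (rule bij_betwI[where g = "\<lambda>(p, q). (U p q, V p q)"])
    show "(\<lambda>x. z *\<^sub>C x - op_app (damped_opr A E f) x) \<in> op_dom (damped_opr A E f) \<rightarrow> phase_space A E"
    proof (clarsimp simp: op_dom_damped phase_space_eq T)
      fix u v assume "L2 u r" "L2 v r"
      then show "L2 (z *\<^sub>C u - v) r"
        using L2_add_vector[OF L2_scaleC_vector[of u r z] L2_scaleC_vector[of v r "-1"]]
        by (simp add: scaleC_minus_left)
    qed
    show "(\<lambda>(p, q). (U p q, V p q)) \<in> phase_space A E \<rightarrow> op_dom (damped_opr A E f)"
      using U_r V_r weak by (fastforce simp: op_dom_damped phase_space_eq)
    show "(\<lambda>(p, q). (U p q, V p q)) (z *\<^sub>C x - op_app (damped_opr A E f) x) = x"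
      if "x \<in> op_dom (damped_opr A E f)" for x
      using that left by (auto simp: op_dom_damped T)
    show "z *\<^sub>C ((\<lambda>(p, q). (U p q, V p q)) y) - op_app (damped_opr A E f) ((\<lambda>(p, q). (U p q, V p q)) y) = y"
      if "y \<in> phase_space A E" for y
      using zU by (cases y) (simp add: T[OF weak])
  qed
  moreover have "\<exists>C. \<forall>x\<in>op_dom (damped_opr A E f).
      phase_norm A E x \<le> C * phase_norm A E (z *\<^sub>C x - op_app (damped_opr A E f) x)"
  proof -
    obtain K1 where K1: "0 \<le> K1" "\<And>x h. L2 x h \<Longrightarrow> norm (fc (\<lambda>s. g s * h s) x) \<le> K1 * norm (fc h x)"
      using norm_fc_bdd_le[OF g] by metis
    obtain K2 where K2: "0 \<le> K2" "\<And>x h. L2 x h \<Longrightarrow> norm (fc (\<lambda>s. r s * i s * h s) x) \<le> K2 * norm (fc h x)"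
      using norm_fc_bdd_le[OF ri] by metis
    obtain K3 where K3: "0 \<le> K3" "\<And>x h. L2 x h \<Longrightarrow> norm (fc (\<lambda>s. i s * h s) x) \<le> K3 * norm (fc h x)"
      using norm_fc_bdd_le[OF i] by metis
    \<comment> \<open>\<open>K1\<close> bounds the entry from \<open>p\<close> to \<open>u\<close>,
      \<open>K2\<close> those from \<open>q\<close> to \<open>u\<close> and from \<open>p\<close> to
      \<open>v\<close>, and \<open>cmod z * K3\<close> the one from \<open>q\<close> to
      \<open>v\<close>.\<close>
    define C where "C = K1 + K2 + K2 + cmod z * K3"
    have bound: "phase_norm A E (U p q, V p q) \<le> C * phase_norm A E (p, q)" if p: "L2 p r" for p q
    proof -
      define N where "N = phase_norm A E (p, q)"
      have N: "norm (fc r p) \<le> N" "norm q \<le> N"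
        unfolding N_def phase_norm_eq[OF p] by (auto intro: real_le_rsqrt)
      have gp: "L2 (fc g p) r"
        using g p by (rule L2_fc)
      have "fc r (U p q) = fc (\<lambda>s. g s * r s) p + fc (\<lambda>s. r s * i s * 1) q"
        using g i gp iq by (simp add: U_def fc_add_vector fc_mult mult.commute[of "r _" "g _"])
      then have "norm (fc r (U p q)) \<le> K1 * norm (fc r p) + K2 * norm q"
        using norm_triangle_mono[OF K1(2)[OF p] K2(2)[OF L2_const[of q 1]]] by (simp add: fc_one)
      also have "\<dots> \<le> K1 * N + K2 * N"
        using N K1(1) K2(1) by (intro add_mono mult_left_mono)
      finally have 1: "norm (fc r (U p q)) \<le> K1 * N + K2 * N" .
      \<comment> \<open>One factor \<open>r\<close> is absorbed by the energy norm of
        \<open>p\<close>; the other stays in the bounded symbol \<open>r * i\<close>.\<close>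
      have "(\<lambda>s. a s * i s) = (\<lambda>s. r s * i s * r s)"
        using r_r by (auto simp: mult.commute mult.left_commute)
      then have ai_le: "norm (fc (\<lambda>s. a s * i s) p) \<le> K2 * norm (fc r p)"
        using K2(2)[OF p] by simp
      have "norm (V p q) \<le> cmod z * norm (fc i q) + norm (fc (\<lambda>s. a s * i s) p)"
        unfolding V_def using norm_triangle_ineq4 by (metis norm_scaleC)
      also have "\<dots> \<le> cmod z * (K3 * N) + K2 * N"
      proof (intro add_mono mult_left_mono)
        show "norm (fc i q) \<le> K3 * N"
          using K3(2)[OF L2_const[of q 1]] N K3(1) by (simp add: fc_one) (meson mult_left_mono order_trans)
        show "norm (fc (\<lambda>s. a s * i s) p) \<le> K2 * N"
          using ai_le N K2(1) by (meson mult_left_mono order_trans)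
      qed auto
      finally have 2: "norm (V p q) \<le> cmod z * (K3 * N) + K2 * N" .
      have "phase_norm A E (U p q, V p q) \<le> norm (fc r (U p q)) + norm (V p q)"
        unfolding phase_norm_eq[OF U_r[OF p]] by (rule sqrt_sum_squares_le_sum) auto
      then show ?thesis
        using 1 2 unfolding C_def N_def by (simp add: algebra_simps)
    qed
    have "phase_norm A E x \<le> C * phase_norm A E (z *\<^sub>C x - op_app (damped_opr A E f) x)"
      if "x \<in> op_dom (damped_opr A E f)" for x
    proof -
      obtain u v h where x: "x = (u, v)" "L2 u r" "L2 v r" and w: "weak_sum A (func_calc A E f) u v h"
        using \<open>x \<in> op_dom (damped_opr A E f)\<close> by (auto simp: op_dom_damped)
      have "L2 (z *\<^sub>C u - v) r"
        using L2_add_vector[OF L2_scaleC_vector[of u r z] L2_scaleC_vector[of v r "-1"]] x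
        by (simp add: scaleC_minus_left)
      from bound[OF this, of "z *\<^sub>C v + h"] show ?thesis
        using left[OF w] by (simp add: x T[OF w])
    qed
    then show ?thesis by blast
  qed
  ultimately show ?thesis
    by (simp add: resolvent_set_def)
qed

end

section \<open>The spectrum of the damped operator\<close>

text \<open>In both cases the roots are \<open>p + q\<close> and \<open>p - q\<close> with
  \<open>p = - f s / 2\<close> and \<open>p\<^sup>2 - q\<^sup>2 = s\<close>; in the second case
  \<open>q\<close> is imaginary.\<close>

lemma xi_factorization:
  fixes z :: complex
  assumes "0 \<le> s" "0 \<le> f s"
  shows "(z - xi_plus f s) * (z - xi_minus f s) = z\<^sup>2 + z * complex_of_real (f s) + complex_of_real s"
proof -
  have *: "(z - (p + q)) * (z - (p - q)) = z\<^sup>2 + z * w + t"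
    if "p = - w / 2" "p\<^sup>2 - q\<^sup>2 = t" for p q w t
  proof -
    have "(z - (p + q)) * (z - (p - q)) = z\<^sup>2 - 2 * p * z + (p\<^sup>2 - q\<^sup>2)"
      by (simp add: algebra_simps power2_eq_square)
    then show ?thesis
      using that by simp
  qed
  show ?thesis
  proof (cases "2 * sqrt s \<le> f s")
    case True
    then have "(2 * sqrt s)\<^sup>2 \<le> (f s)\<^sup>2"
      using assms by (intro power_mono) auto
    then have "4 * s \<le> (f s)\<^sup>2"
      using assms by (simp add: power_mult_distrib)
    then have "(- f s / 2)\<^sup>2 - (sqrt ((f s)\<^sup>2 - 4 * s) / 2)\<^sup>2 = s"
      by (simp add: power_divide diff_divide_distrib)
    then have "(complex_of_real (- f s / 2))\<^sup>2 - (complex_of_real (sqrt ((f s)\<^sup>2 - 4 * s) / 2))\<^sup>2 = complex_of_real s"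
      by (simp only: of_real_diff[symmetric] of_real_power[symmetric])
    then show ?thesis
      unfolding xi_plus_def xi_minus_def using True
      by (simp only: if_True of_real_add of_real_diff) (rule *, simp_all)
  next
    case False
    then have "(f s)\<^sup>2 \<le> (2 * sqrt s)\<^sup>2"
      using assms by (intro power_mono) auto
    then have "(f s)\<^sup>2 \<le> 4 * s"
      using assms by (simp add: power_mult_distrib)
    then have "(- f s / 2)\<^sup>2 + (sqrt (4 * s - (f s)\<^sup>2) / 2)\<^sup>2 = s"
      by (simp add: power_divide diff_divide_distrib)
    then have "(complex_of_real (- f s / 2))\<^sup>2 + (complex_of_real (sqrt (4 * s - (f s)\<^sup>2) / 2))\<^sup>2 = complex_of_real s"
      by (simp only: of_real_add[symmetric] of_real_power[symmetric])
    then have "(complex_of_real (- f s / 2))\<^sup>2 - (\<i> * complex_of_real (sqrt (4 * s - (f s)\<^sup>2) / 2))\<^sup>2 = complex_of_real s"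
      by (simp only: power_mult_distrib power2_i) simp
    then show ?thesis
      unfolding xi_plus_def xi_minus_def using False
      by (simp only: if_False) (rule *, simp_all)
  qed
qed

context damped
begin

lemma m_in_S: "s \<in> S \<Longrightarrow> m z s = z\<^sup>2 + z * complex_of_real (f s) + complex_of_real s"
  by (simp add: m_def symbols_in_S)

lemma m_eq_0_iff: "s \<in> S \<Longrightarrow> m z s = 0 \<longleftrightarrow> z \<in> {xi_plus f s, xi_minus f s}"
  using xi_factorization[of s f z] S_pos[of s] nonneg[of s]
  by (auto simp: m_in_S)

lemma continuous_on_m: "continuous_on S (m z)"
proof -
  have "continuous_on S (\<lambda>s. z\<^sup>2 + z * complex_of_real (f s) + complex_of_real s)"
    by (intro continuous_intros cont)
  then show ?thesis
    by (rule continuous_on_eq) (simp add: m_in_S)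
qed

lemma m_over_s:
  "s \<in> S \<Longrightarrow> m z s / complex_of_real s = z\<^sup>2 / complex_of_real s + z * complex_of_real (f s / s) + 1"
  using S_pos[of s] by (simp add: m_in_S field_simps)

text \<open>For large \<open>s\<close> a violating sequence would have a limit ratio
  \<open>- 1 / z\<close>. The ratio \<open>f s / s\<close> is not bounded in advance, but it enters
  the error with a factor tending to zero and is absorbed by \<open>z * f s / s\<close>, as
  \<open>z \<noteq> 0\<close>. On the bounded part of the closed set \<open>S\<close>, continuity
  and the absence of roots suffice by compactness.\<close>

lemma m_bounded_below:
  assumes "z \<noteq> 0" and no_root: "\<And>s. s \<in> S \<Longrightarrow> z \<notin> {xi_plus f s, xi_minus f s}"
    and no_limit: "\<And>l. l \<in> limit_ratios S f \<Longrightarrow> z \<noteq> complex_of_real (- 1 / l)"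
  obtains c where "c > 0" "\<And>s. s \<in> S \<Longrightarrow> c * (1 + s + f s) \<le> cmod (m z s)"
proof -
  \<comment> \<open>A single \<open>n\<close> is both threshold and, through
    \<open>inverse (real (Suc n))\<close>, constant, so the negation directly yields a sequence
    going to infinity. With \<open>inverse (real n)\<close> the case \<open>n = 0\<close> would hold
    trivially, as \<open>inverse 0 = 0\<close>.\<close>
  have "\<exists>n::nat. \<forall>s\<in>S. real n \<le> s \<longrightarrow> inverse (real (Suc n)) * (1 + s + f s) \<le> cmod (m z s)"
  proof (rule ccontr)
    assume "\<not> ?thesis"
    then have "\<forall>n::nat. \<exists>s. s \<in> S \<and> real n \<le> s \<and> cmod (m z s) < inverse (real (Suc n)) * (1 + s + f s)"
      by (auto simp: not_le)
    then obtain s where s: "\<And>n. s n \<in> S" "\<And>n. real n \<le> s n"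
      "\<And>n. cmod (m z (s n)) < inverse (real (Suc n)) * (1 + s n + f (s n))"
      by metis
    have s_top: "filterlim s at_top sequentially"
      using filterlim_at_top_mono[OF filterlim_real_sequentially, of s] s(2) by auto
    define \<rho> where "\<rho> n = f (s n) / s n" for n
    have sp: "s n > 0" "0 \<le> f (s n)" for n
      using S_pos nonneg s by auto
    \<comment> \<open>The error terms that vanish in the limit; the remaining one is
      \<open>inverse (real (Suc n))\<close> times the distance of \<open>\<rho> n\<close> from
      \<open>- 1 / z\<close> and is moved to the left in \<open>main\<close>.\<close>
    define e where "e n = inverse (real (Suc n)) * (1 / s n + 1 + cmod (1 / z)) + cmod (z\<^sup>2) / s n" for n
    have inv_s: "(\<lambda>n. 1 / s n) \<longlonglongrightarrow> 0"
      using tendsto_inverse_0_at_top[OF s_top] by (simp add: inverse_eq_divide)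
    have "e \<longlonglongrightarrow> 0 * (0 + 1 + cmod (1 / z)) + cmod (z\<^sup>2) * 0"
      unfolding e_def using tendsto_mult[OF tendsto_const[of "cmod (z\<^sup>2)"] inv_s]
      by (intro tendsto_add tendsto_mult LIMSEQ_inverse_real_of_nat inv_s tendsto_const) simp
    then have e0: "e \<longlonglongrightarrow> 0" by simp
    have main: "(cmod z - inverse (real (Suc n))) * cmod (complex_of_real (\<rho> n) - - 1 / z) \<le> e n" for n
    proof -
      let ?x = "complex_of_real (\<rho> n) - - 1 / z" and ?t = "inverse (real (Suc n))"
      have "z * ?x = m z (s n) / complex_of_real (s n) - z\<^sup>2 / complex_of_real (s n)"
        using \<open>z \<noteq> 0\<close> by (simp add: m_over_s[OF s(1)] \<rho>_def algebra_simps)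
      then have "cmod z * cmod ?x \<le> cmod (m z (s n)) / s n + cmod (z\<^sup>2) / s n"
        using norm_triangle_ineq4[of "m z (s n) / complex_of_real (s n)" "z\<^sup>2 / complex_of_real (s n)"] sp(1)[of n]
        by (simp add: norm_mult[symmetric] norm_divide)
      also have "cmod (m z (s n)) / s n \<le> ?t * (1 + s n + f (s n)) / s n"
        using s(3)[of n] sp(1)[of n] by (intro divide_right_mono) auto
      also have "\<dots> = ?t * (1 / s n + 1 + \<rho> n)"
        using sp(1)[of n] by (simp add: \<rho>_def field_simps)
      also have "\<rho> n \<le> cmod ?x + cmod (1 / z)"
      proof -
        have "\<bar>\<rho> n\<bar> = cmod (?x + - 1 / z)"
          by (simp add: norm_of_real)
        also have "\<dots> \<le> cmod ?x + cmod (- 1 / z)"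
          by (rule norm_triangle_ineq)
        finally show ?thesis by (simp add: norm_divide)
      qed
      finally have "cmod z * cmod ?x \<le> ?t * (1 / s n + 1 + (cmod ?x + cmod (1 / z))) + cmod (z\<^sup>2) / s n"
        by (simp add: mult_left_mono)
      then show ?thesis
        by (simp add: e_def algebra_simps)
    qed
    have "(\<lambda>n. cmod (complex_of_real (\<rho> n) - - 1 / z)) \<longlonglongrightarrow> 0"
    proof (rule tendsto_sandwich[OF _ _ tendsto_const])
      show "(\<lambda>n. 2 / cmod z * e n) \<longlonglongrightarrow> 0"
        using tendsto_mult_right_zero[OF e0] by blast
      \<comment> \<open>From here on the coefficient on the left of \<open>main\<close> exceeds
        \<open>cmod z / 2\<close>.\<close>
      have "eventually (\<lambda>n. inverse (real (Suc n)) < cmod z / 2) sequentially"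
        using \<open>z \<noteq> 0\<close> by (intro order_tendstoD(2)[OF LIMSEQ_inverse_real_of_nat]) simp
      then show "eventually (\<lambda>n. cmod (complex_of_real (\<rho> n) - - 1 / z) \<le> 2 / cmod z * e n) sequentially"
      proof eventually_elim
        case (elim n)
        have "cmod z / 2 * cmod (complex_of_real (\<rho> n) - - 1 / z)
            \<le> (cmod z - inverse (real (Suc n))) * cmod (complex_of_real (\<rho> n) - - 1 / z)"
          using elim by (intro mult_right_mono) auto
        with main[of n] have "cmod z / 2 * cmod (complex_of_real (\<rho> n) - - 1 / z) \<le> e n"
          by linarith
        then show ?case
          using \<open>z \<noteq> 0\<close> by (simp add: field_simps)
      qed
    qed simp
    then have "(\<lambda>n. complex_of_real (\<rho> n) - - 1 / z) \<longlonglongrightarrow> 0"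
      using tendsto_norm_zero_iff by blast
    then have lim: "(\<lambda>n. complex_of_real (\<rho> n)) \<longlonglongrightarrow> - 1 / z"
      by (rule LIM_zero_cancel)
    define l where "l = Re (- 1 / z)"
    have \<rho>l: "\<rho> \<longlonglongrightarrow> l"
      using tendsto_Re[OF lim] by (simp add: l_def)
    then have lz: "complex_of_real l = - 1 / z"
      by (intro LIMSEQ_unique[OF _ lim] tendsto_of_real)
    have "0 \<le> l"
      using \<rho>l by (rule LIMSEQ_le_const) (use sp in \<open>auto simp: \<rho>_def less_imp_le\<close>)
    moreover have "l \<noteq> 0"
      using lz \<open>z \<noteq> 0\<close> by auto
    ultimately have "l \<in> limit_ratios S f"
      using s(1) s_top \<rho>l unfolding limit_ratios_def \<rho>_def by auto
    moreover have "z = complex_of_real (- 1 / l)"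
      using lz \<open>z \<noteq> 0\<close> \<open>l \<noteq> 0\<close> by (simp add: field_simps)
    ultimately show False
      using no_limit by blast
  qed
  then obtain n :: nat where n: "\<And>s. s \<in> S \<Longrightarrow> real n \<le> s \<Longrightarrow> inverse (real (Suc n)) * (1 + s + f s) \<le> cmod (m z s)"
    by blast
  define Q where "Q s = cmod (m z s) / (1 + s + f s)" for s
  define S0 where "S0 = S \<inter> {0..real n}"
  have den: "0 < 1 + s + f s" if "s \<in> S" for s
    using S_pos[OF that] nonneg[OF that] by simp
  obtain c0 where c0: "c0 > 0" "\<And>s. s \<in> S0 \<Longrightarrow> c0 \<le> Q s"
  proof (cases "S0 = {}")
    case False
    have "compact S0"
      unfolding S0_def using closed_real_spectrum by (rule closed_Int_compact) auto
    moreover have "continuous_on S0 Q"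
    proof -
      have "continuous_on S0 f" "continuous_on S0 (m z)"
        using cont continuous_on_m by (auto intro: continuous_on_subset simp: S0_def)
      moreover have "1 + s + f s \<noteq> 0" if "s \<in> S0" for s
        using den that by (force simp: S0_def)
      ultimately show ?thesis
        unfolding Q_def by (auto intro!: continuous_intros)
    qed
    ultimately obtain t where t: "t \<in> S0" "\<And>s. s \<in> S0 \<Longrightarrow> Q t \<le> Q s"
      using continuous_attains_inf[of S0 Q] False by blast
    then have "m z t \<noteq> 0"
      using no_root m_eq_0_iff by (auto simp: S0_def)
    then have "Q t > 0"
      using den t by (auto simp: Q_def S0_def)
    with t that show ?thesis by blast
  \<comment> \<open>If \<open>S\<close> has no points up to \<open>n\<close>, any positive constant
    serves.\<close>
  qed (use that[of 1] in auto)
  show ?thesis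
  proof (rule that[of "min c0 (inverse (real (Suc n)))"])
    show "min c0 (inverse (real (Suc n))) * (1 + s + f s) \<le> cmod (m z s)" if s: "s \<in> S" for s
    proof (cases "real n \<le> s")
      case True
      then show ?thesis
        using n[OF s] den[OF s] by (meson less_imp_le min.cobounded2 mult_right_mono order_trans)
    next
      case False
      then have "c0 \<le> Q s"
        using c0 s S_pos[OF s] by (auto simp: S0_def)
      then have "c0 * (1 + s + f s) \<le> cmod (m z s)"
        using den[OF s] by (simp add: Q_def field_simps)
      then show ?thesis
        using den[OF s] by (meson less_imp_le min.cobounded1 mult_right_mono order_trans)
    qed
  qed (use c0 in auto)
qed

text \<open>
  The approximate eigenvectors are \<open>u = (z + f(A)) x\<close>, \<open>v = - A x\<close> with \<open>x\<close> in a small spectral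
  subspace; \<open>z\<close> minus the operator maps them to \<open>(m(A) x, 0)\<close>. The simpler choice \<open>u = x\<close>,
  \<open>v = z x\<close> would fail for the limit points \<open>- 1 / l\<close>, where \<open>m = o(s)\<close> but not \<open>o(sqrt s)\<close>.
\<close>

lemma not_resolvent_if_approximable:
  assumes app: "\<And>e. e > 0 \<Longrightarrow> \<exists>s\<in>S. cmod (m z s) < e * (sqrt s + cmod (z + complex_of_real (f s)))"
  shows "z \<notin> resolvent_set (phase_space A E) (phase_norm A E) (damped_opr A E f)"
proof
  assume "z \<in> resolvent_set (phase_space A E) (phase_norm A E) (damped_opr A E f)"
  then obtain C where C: "\<And>x. x \<in> op_dom (damped_opr A E f) \<Longrightarrow>
      phase_norm A E x \<le> C * phase_norm A E (z *\<^sub>C x - op_app (damped_opr A E f) x)"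
    by (auto simp: resolvent_set_def)
  \<comment> \<open>The image of the approximate eigenvector will be at most \<open>2 * e\<close>
    times its norm, one \<open>e\<close> for each component.\<close>
  define e where "e = 1 / (4 * (\<bar>C\<bar> + 1))"
  have e: "e > 0" "\<bar>C\<bar> * (2 * e) < 1"
    by (auto simp: e_def field_simps add_pos_nonneg)
  obtain s0 where s0: "s0 \<in> S" "cmod (m z s0) < e * (sqrt s0 + cmod (z + complex_of_real (f s0)))"
    using app[OF e(1)] by blast
  \<comment> \<open>\<open>Q s0 > 0\<close> expresses the strict inequality at \<open>s0\<close>;
    continuity spreads it to nearby points of \<open>S\<close>.\<close>
  define Q where "Q s = e * (sqrt s + cmod (z + complex_of_real (f s))) - cmod (m z s)" for s
  have "continuous_on S Q"
    unfolding Q_def by (intro continuous_intros cont continuous_on_m)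
  then obtain d0 where d0: "d0 > 0" "\<And>s. s \<in> S \<Longrightarrow> dist s s0 < d0 \<Longrightarrow> dist (Q s) (Q s0) < Q s0"
  proof -
    have "0 < Q s0"
      using s0 by (simp add: Q_def)
    then show ?thesis
      using \<open>continuous_on S Q\<close> s0(1) that unfolding continuous_on_iff by meson
  qed
  obtain d1 where d1: "d1 > 0" "\<And>s. s \<in> S \<Longrightarrow> dist s s0 < d1 \<Longrightarrow> dist (f s) (f s0) < 1"
    using cont s0(1) unfolding continuous_on_iff by (meson zero_less_one)
  \<comment> \<open>\<open>s0 / 2\<close> keeps the window away from \<open>0\<close> and bounded,
    \<open>d0\<close> preserves the inequality, \<open>d1\<close> bounds \<open>f\<close>.\<close>
  define d where "d = min (s0 / 2) (min d0 d1)"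
  have d: "d > 0"
    using d0 d1 S_pos[OF s0(1)] by (auto simp: d_def)
  define B where "B = {s0 - d<..<s0 + d} \<inter> S"
  have B [measurable]: "B \<in> sets borel"
    unfolding B_def by measurable
  have B_S: "s \<in> S" if "s \<in> B" for s
    using that by (simp add: B_def)
  have near: "\<bar>s - s0\<bar> < d" if "s \<in> B" for s
    using that unfolding B_def by (simp add: abs_less_iff)
  have lower: "s0 / 2 \<le> s" and upper: "s \<le> 2 * s0" and f_le: "f s \<le> f s0 + 1" if "s \<in> B" for s
  proof -
    show "s0 / 2 \<le> s" "s \<le> 2 * s0"
      using near[OF that] unfolding d_def by linarith+
    show "f s \<le> f s0 + 1"
      using d1(2)[OF B_S[OF that]] near[OF that] by (auto simp: d_def dist_real_def)
  qed
  have m_le: "cmod (m z s) \<le> e * (sqrt s + cmod (z + b s))" if "s \<in> B" for s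
    using d0(2)[OF B_S[OF that]] near[OF that] B_S[OF that]
    by (auto simp: d_def dist_real_def Q_def symbols_in_S)
  \<comment> \<open>Intersecting the window with \<open>S\<close> does not change its projection,
    since the measures are carried by \<open>S\<close>.\<close>
  obtain x where x: "E B x \<noteq> 0"
  proof -
    obtain x where x: "E {s0 - d<..<s0 + d} x \<noteq> 0"
      using real_spectrum_imp_E_nonzero[OF s0(1) d] by blast
    have "fc (indicator {s0 - d<..<s0 + d}) x = fc (indicator B) x"
    proof (rule fc_cong_AE)
      show "AE s in \<mu> x. indicator {s0 - d<..<s0 + d} s = (indicator B s :: complex)"
        using AE_in_S[of x] by eventually_elim (auto simp: B_def indicator_def)
    qed (auto intro!: L2_bdd_borel bdd_borel_indicator B)
    then show ?thesis
      using x that by (simp add: fc_indicator)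
  qed
  define \<beta> where "\<beta> = (indicator B :: real \<Rightarrow> complex)"
  have bd: "bdd_borel \<beta>"
    unfolding \<beta>_def by (rule bdd_borel_indicator) measurable
  have [measurable]: "\<beta> \<in> borel_measurable borel"
    using bd by (simp add: bdd_borel_def)
  have \<beta>0: "\<beta> s = 0" if "s \<notin> B" for s
    using that by (simp add: \<beta>_def)
  have \<beta>1: "\<beta> s = 1" if "s \<in> B" for s
    using that by (simp add: \<beta>_def)
  have s0p: "0 < s0" and f0p: "0 \<le> f s0"
    using S_pos nonneg s0 by auto
  have a\<beta>: "bdd_borel (\<lambda>s. a s * \<beta> s)"
  proof (rule bdd_borelI[where K = "2 * s0"])
    show "cmod (a s * \<beta> s) \<le> 2 * s0" for s
      using upper[of s] S_pos[of s] B_S[of s] s0p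
      by (cases "s \<in> B") (auto simp: \<beta>0 \<beta>1 symbols_in_S)
  qed measurable
  have b\<beta>: "bdd_borel (\<lambda>s. b s * \<beta> s)"
  proof (rule bdd_borelI[where K = "f s0 + 1"])
    show "cmod (b s * \<beta> s) \<le> f s0 + 1" for s
      using f_le[of s] nonneg[of s] B_S[of s] f0p
      by (cases "s \<in> B") (auto simp: \<beta>0 \<beta>1 symbols_in_S)
  qed measurable
  have r\<beta>: "bdd_borel (\<lambda>s. r s * \<beta> s)"
  proof (rule bdd_borelI[where K = "sqrt (2 * s0)"])
    show "cmod (r s * \<beta> s) \<le> sqrt (2 * s0)" for s
      using upper[of s] S_pos[of s] B_S[of s] s0p
      by (cases "s \<in> B") (auto simp: \<beta>0 \<beta>1 symbols_in_S)
  qed measurable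
  have \<beta>\<beta>: "\<beta> s * \<beta> s = \<beta> s" "\<beta> s * (\<beta> s * t) = \<beta> s * t" for s t
    by (cases "s \<in> B"; simp add: \<beta>0 \<beta>1)+
  define zb where "zb s = (z + b s) * \<beta> s" for s
  have zb: "bdd_borel zb"
    using bdd_borel_add[OF bdd_borel_mult[OF bdd_borel_const bd] b\<beta>, of z]
    by (simp add: zb_def[abs_def] distrib_right)
  have rzb: "bdd_borel (\<lambda>s. r s * zb s)"
    using bdd_borel_mult[OF r\<beta> zb] by (simp add: zb_def \<beta>\<beta> ac_simps)
  have mb: "bdd_borel (\<lambda>s. m z s * \<beta> s)"
    using bdd_borel_add[OF bdd_borel_mult[OF bdd_borel_const zb] a\<beta>, of z]
    by (simp add: zb_def m_def algebra_simps power2_eq_square)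
  have ra\<beta>: "bdd_borel (\<lambda>s. r s * (a s * \<beta> s))"
    using bdd_borel_mult[OF r\<beta> a\<beta>] by (simp add: \<beta>\<beta> ac_simps)
  have rmb: "bdd_borel (\<lambda>s. r s * (m z s * \<beta> s))"
    using bdd_borel_mult[OF r\<beta> mb] by (simp add: \<beta>\<beta> ac_simps)
  define u where "u = fc zb x"
  define v where "v = (- 1) *\<^sub>C fc (\<lambda>s. a s * \<beta> s) x"
  have u_r: "L2 u r" and v_r: "L2 v r"
    unfolding u_def v_def using zb rzb a\<beta> ra\<beta> by (auto intro!: L2_scaleC_vector simp: L2_fc_iff)
  have weak: "weak_sum A (func_calc A E f) u v (z *\<^sub>C fc (\<lambda>s. a s * \<beta> s) x)"
  proof -
    have "fc (\<lambda>s. a s * k s) u + fc (\<lambda>s. b s * k s) v =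
        fc (\<lambda>s. a s * k s * zb s) x + (- 1) *\<^sub>C fc (\<lambda>s. b s * k s * (a s * \<beta> s)) x"
      using bdd_k zb a\<beta> by (simp add: u_def v_def fc_bdd_mult fc_scaleC_vector)
    also have "\<dots> = fc (\<lambda>s. a s * k s * zb s + (- 1) * (b s * k s * (a s * \<beta> s))) x"
      using bdd_k zb a\<beta> by (simp only: fc_add fc_scale L2_bdd_borel bdd_borel_mult bdd_borel_const)
    also have "(\<lambda>s. a s * k s * zb s + (- 1) * (b s * k s * (a s * \<beta> s))) = (\<lambda>s. z * (k s * (a s * \<beta> s)))"
      by (simp add: zb_def algebra_simps)
    also have "fc \<dots> x = fc k (z *\<^sub>C fc (\<lambda>s. a s * \<beta> s) x)"
      using bdd_k a\<beta> by (simp add: fc_bdd_mult fc_scaleC_vector fc_scale)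
    finally show ?thesis
      by (simp add: weak_sum_iff)
  qed
  have T: "z *\<^sub>C (u, v) - op_app (damped_opr A E f) (u, v) = (fc (\<lambda>s. m z s * \<beta> s) x, 0)"
  proof -
    have "z *\<^sub>C u - v = fc (\<lambda>s. z * zb s + a s * \<beta> s) x"
      using zb a\<beta> by (simp add: u_def v_def scaleC_minus_left fc_add fc_scale)
    also have "(\<lambda>s. z * zb s + a s * \<beta> s) = (\<lambda>s. m z s * \<beta> s)"
      by (simp add: zb_def m_def algebra_simps power2_eq_square)
    finally have "z *\<^sub>C u - v = fc (\<lambda>s. m z s * \<beta> s) x" .
    moreover have "z *\<^sub>C v + z *\<^sub>C fc (\<lambda>s. a s * \<beta> s) x = 0"
      by (simp add: v_def scaleC_minus_left scaleC_minus_right)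
    ultimately show ?thesis
      by (simp add: op_app_damped[OF weak] scaleC_prod_def)
  qed
  define N where "N = phase_norm A E (u, v)"
  have nv: "norm v = norm (fc (\<lambda>s. a s * \<beta> s) x)"
    by (simp add: v_def norm_scaleC)
  have nu: "fc r u = fc (\<lambda>s. r s * zb s) x"
    using zb u_r by (simp add: u_def fc_mult)
  have N: "norm (fc r u) \<le> N" "norm v \<le> N"
    unfolding N_def phase_norm_eq[OF u_r] by (auto intro: real_le_rsqrt)
  \<comment> \<open>The nonzero component is \<open>v\<close>, whose symbol is at least
    \<open>s0 / 2\<close> in modulus on \<open>B\<close>; \<open>u\<close> may vanish where
    \<open>z + f s = 0\<close>.\<close>
  have Npos: "N > 0"
  proof -
    have "norm (fc \<beta> x) \<le> 2 / s0 * norm (fc (\<lambda>s. a s * \<beta> s) x)"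
    proof (rule norm_fc_le)
      show "AE s in \<mu> x. cmod (\<beta> s) \<le> 2 / s0 * cmod (a s * \<beta> s)"
      proof (rule AE_I2)
        fix s show "cmod (\<beta> s) \<le> 2 / s0 * cmod (a s * \<beta> s)"
          using lower[of s] S_pos[of s] B_S[of s] s0p
          by (cases "s \<in> B") (auto simp: \<beta>0 \<beta>1 symbols_in_S field_simps)
      qed
    qed (use bd a\<beta> s0p in auto)
    then have "fc (\<lambda>s. a s * \<beta> s) x \<noteq> 0"
      using x fc_indicator[OF B, of x] by (auto simp: \<beta>_def)
    then show ?thesis
      using N(2) nv by (smt (verit) zero_less_norm_iff)
  qed
  have Lm: "L2 (fc (\<lambda>s. m z s * \<beta> s) x) r"
    using mb rmb by (simp add: L2_fc_iff)
  have "norm (fc r (fc (\<lambda>s. m z s * \<beta> s) x)) = norm (fc (\<lambda>s. r s * (m z s * \<beta> s)) x)"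
    using mb Lm by (simp add: fc_mult)
  \<comment> \<open>Multiplying \<open>m_le\<close> by \<open>sqrt s\<close> gives \<open>e\<close>
    times \<open>s + sqrt s * cmod (z + b s)\<close>, the moduli of the symbols of \<open>v\<close>
    and of \<open>fc r u\<close>. Passing to moduli prevents cancellation in the sum, and the norms
    of both terms are bounded by \<open>N\<close>.\<close>
  also have "\<dots> \<le> e * norm (fc (\<lambda>s. a s * \<beta> s + complex_of_real (cmod (r s * zb s))) x)"
  proof (rule norm_fc_le)
    show "AE s in \<mu> x. cmod (r s * (m z s * \<beta> s)) \<le> e * cmod (a s * \<beta> s + complex_of_real (cmod (r s * zb s)))"
    proof (rule AE_I2)
      fix s show "cmod (r s * (m z s * \<beta> s)) \<le> e * cmod (a s * \<beta> s + complex_of_real (cmod (r s * zb s)))"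
      proof (cases "s \<in> B")
        case True
        then have sS: "s \<in> S" and sp: "0 < s"
          using B_S S_pos by auto
        have "a s * \<beta> s + complex_of_real (cmod (r s * zb s)) = complex_of_real (s + sqrt s * cmod (z + b s))"
          using True sS sp by (simp add: symbols_in_S \<beta>1 zb_def norm_mult)
        moreover have "sqrt s * cmod (m z s) \<le> sqrt s * (e * (sqrt s + cmod (z + b s)))"
          using sp by (intro mult_left_mono m_le True) auto
        moreover have "sqrt s * (e * (sqrt s + cmod (z + b s))) = e * (s + sqrt s * cmod (z + b s))"
          using sp by (simp add: algebra_simps)
        moreover have "0 \<le> s + sqrt s * cmod (z + b s)"
          using sp by simp
        ultimately show ?thesis
          using True sS sp by (simp only: norm_of_real) (simp add: symbols_in_S \<beta>1 norm_mult)
      qed (simp add: \<beta>0 zb_def)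
    qed
    show "L2 x (\<lambda>s. a s * \<beta> s + complex_of_real (cmod (r s * zb s)))"
      using a\<beta> rzb by (intro L2_add L2_cmod L2_bdd_borel)
  qed (use rmb e in auto)
  also have "fc (\<lambda>s. a s * \<beta> s + complex_of_real (cmod (r s * zb s))) x =
      fc (\<lambda>s. a s * \<beta> s) x + fc (\<lambda>s. complex_of_real (cmod (r s * zb s))) x"
    using a\<beta> rzb by (intro fc_add L2_cmod L2_bdd_borel)
  also have "norm \<dots> \<le> N + N"
  proof -
    have "norm (fc (\<lambda>s. complex_of_real (cmod (r s * zb s))) x) \<le> 1 * norm (fc (\<lambda>s. r s * zb s) x)"
      using rzb by (intro norm_fc_le L2_cmod L2_bdd_borel) auto
    then show ?thesis
      using N nu nv by (intro norm_triangle_mono) auto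
  qed
  finally have out: "norm (fc r (fc (\<lambda>s. m z s * \<beta> s) x)) \<le> e * (N + N)"
    using e by simp
  have "N \<le> C * norm (fc r (fc (\<lambda>s. m z s * \<beta> s) x))"
    using C[of "(u, v)"] u_r v_r weak T phase_norm_eq[OF Lm, of 0] by (auto simp: op_dom_damped N_def)
  also have "\<dots> \<le> \<bar>C\<bar> * (e * (N + N))"
    using out by (intro mult_mono) auto
  also have "\<dots> = \<bar>C\<bar> * (2 * e) * N"
    by simp
  also have "\<dots> < 1 * N"
    using e(2) Npos by (intro mult_strict_right_mono)
  finally show False by simp
qed

text \<open>After division by \<open>s n\<close> the left side tends to
  \<open>cmod (z * l + 1) = 0\<close>, whereas \<open>e * cmod (z + f (s n)) / s n\<close> tends to
  \<open>e * l > 0\<close>.\<close>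

lemma approximable_limit_ratio:
  assumes "l \<in> limit_ratios S f" and z: "z = complex_of_real (- 1 / l)" and "e > 0"
  shows "\<exists>s\<in>S. cmod (m z s) < e * (sqrt s + cmod (z + complex_of_real (f s)))"
proof -
  obtain s where l: "l > 0" and s: "\<And>n::nat. s n \<in> S" and top: "filterlim s at_top sequentially"
    and lim: "(\<lambda>n. f (s n) / s n) \<longlonglongrightarrow> l"
    using assms by (auto simp: limit_ratios_def)
  have "(\<lambda>n. inverse (s n)) \<longlonglongrightarrow> 0"
    using tendsto_inverse_0_at_top[OF top] .
  then have inv: "(\<lambda>n. w / complex_of_real (s n)) \<longlonglongrightarrow> 0" for w
    using tendsto_mult[OF tendsto_const[of w] tendsto_of_real, of "\<lambda>n. inverse (s n)" 0]
    by (simp add: field_simps)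
  have "(\<lambda>n. e * cmod (z / complex_of_real (s n) + complex_of_real (f (s n) / s n))
       - cmod (z\<^sup>2 / complex_of_real (s n) + z * complex_of_real (f (s n) / s n) + 1))
     \<longlonglongrightarrow> e * cmod (0 + complex_of_real l) - cmod (0 + z * complex_of_real l + 1)"
    by (intro tendsto_intros inv lim)
  moreover have "e * cmod (0 + complex_of_real l) - cmod (0 + z * complex_of_real l + 1) > 0"
    using l \<open>e > 0\<close> by (simp add: z)
  ultimately have "eventually (\<lambda>n. 0 < e * cmod (z / complex_of_real (s n) + complex_of_real (f (s n) / s n))
       - cmod (z\<^sup>2 / complex_of_real (s n) + z * complex_of_real (f (s n) / s n) + 1)) sequentially"
    by (rule order_tendstoD(1))
  then obtain n where n: "cmod (z\<^sup>2 / complex_of_real (s n) + z * complex_of_real (f (s n) / s n) + 1)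
      < e * cmod (z / complex_of_real (s n) + complex_of_real (f (s n) / s n))"
    by (auto simp: eventually_sequentially)
  have sp: "s n > 0"
    using S_pos s by blast
  have "z / complex_of_real (s n) + complex_of_real (f (s n) / s n) = (z + complex_of_real (f (s n))) / complex_of_real (s n)"
    by (simp add: add_divide_distrib)
  then have "cmod (m z (s n)) / s n < e * (cmod (z + complex_of_real (f (s n))) / s n)"
    using n sp by (simp add: m_over_s[OF s, symmetric] norm_divide del: of_real_divide)
  then have "cmod (m z (s n)) < e * cmod (z + complex_of_real (f (s n)))"
    using sp by (simp add: field_simps)
  also have "\<dots> \<le> e * (sqrt (s n) + cmod (z + complex_of_real (f (s n))))"
    using sp \<open>e > 0\<close> by (intro mult_left_mono) auto
  finally show ?thesis
    using s by blast
qed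

lemma spectrum_damped_opr:
  "spectrum (phase_space A E) (phase_norm A E) (damped_opr A E f) - {0} =
    (\<Union>s\<in>S. {xi_plus f s, xi_minus f s}) \<union> (\<Union>l\<in>limit_ratios S f. {complex_of_real (- 1 / l)})"
    (is "?spec - {0} = ?xi \<union> ?lim")
proof (intro equalityI subsetI)
  fix z assume z: "z \<in> ?spec - {0}"
  show "z \<in> ?xi \<union> ?lim"
  proof (rule ccontr)
    assume n: "z \<notin> ?xi \<union> ?lim"
    obtain c where "c > 0" "\<And>s. s \<in> S \<Longrightarrow> c * (1 + s + f s) \<le> cmod (m z s)"
      by (rule m_bounded_below[of z]) (use z n in auto)
    then show False
      using resolvent_if_bounded_below z by (auto simp: spectrum_def)
  qed
next
  fix z assume "z \<in> ?xi \<union> ?lim"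
  then have "z \<noteq> 0 \<and> (\<forall>e>0. \<exists>s\<in>S. cmod (m z s) < e * (sqrt s + cmod (z + complex_of_real (f s))))"
  proof
    assume "z \<in> ?xi"
    then obtain s where s: "s \<in> S" and m: "m z s = 0"
      using m_eq_0_iff by auto
    \<comment> \<open>At \<open>z = 0\<close> the symbol is \<open>m 0 s = s\<close>, which is
      positive on \<open>S\<close>.\<close>
    have "z \<noteq> 0"
      using m S_pos[OF s] by (auto simp: m_in_S[OF s])
    moreover have "cmod (m z s) < e * (sqrt s + cmod (z + complex_of_real (f s)))" if "e > 0" for e
      using that S_pos[OF s] by (simp add: m add_pos_nonneg)
    ultimately show ?thesis
      using s by blast
  next
    assume "z \<in> ?lim"
    then obtain l where l: "l \<in> limit_ratios S f" and z: "z = complex_of_real (- 1 / l)"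
      by auto
    then have "z \<noteq> 0"
      by (auto simp: limit_ratios_def)
    then show ?thesis
      using approximable_limit_ratio[OF l z] by blast
  qed
  then show "z \<in> ?spec - {0}"
    using not_resolvent_if_approximable by (auto simp: spectrum_def)
qed

end

theorem theorem6p3:
  fixes A :: "'a::complex_hilbert_space opr"
    and E :: "real set \<Rightarrow> 'a \<Rightarrow> 'a"
    and f :: "real \<Rightarrow> real"
  assumes "separable_space (euclidean :: 'a topology)"
    and "selfadjoint A"
    and "strictly_positive A"
    and "spectral_measure_of E A"
    and "continuous_on (real_spectrum A) f"
    and "\<forall>s\<in>real_spectrum A. 0 \<le> f s"
  shows "spectrum (phase_space A E) (phase_norm A E) (damped_opr A E f) - {0} =
    (\<Union>s\<in>real_spectrum A. {xi_plus f s, xi_minus f s}) \<union>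
    (\<Union>l\<in>limit_ratios (real_spectrum A) f. {complex_of_real (- 1 / l)})"
proof -
  interpret damped E A f
    by unfold_locales (use assms in \<open>auto simp: spectral_measure_of_def\<close>)
  show ?thesis
    by (rule spectrum_damped_opr)
qed

end
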